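(* Let $a,b$ be positive integers with $a\le b$ and let $f^{a,b}_1(x,y,z,w)=ax^2+by^2+(z^2+zw+w^2)$ for $x,y,z,w\in\mathbb{Z}$. (1) $f^{a,b}_1$ represents every nonnegative integer if and only if $(a,b)=(1,b)$ with $b\in\{1,2,3,4,5,6\}$ or $(a,b)=(2,b)$ with $b\in\{2,3,4,5,6,7,8,9,10\}$. (2) If $f^{a,b}_1$ represents $n=1,2,6,10$, then it represents every nonnegative integer.
   Context: A form represents $n$ if $n$ equals the form evaluated at some integer arguments. *)

theory Defs
  imports Main
begin

definition f1 :: "int \<Rightarrow> int \<Rightarrow> int \<Rightarrow> int \<Rightarrow> int \<Rightarrow> int \<Rightarrow> int" where
  "f1 a b x y z w = a * x^2 + b * y^2 + (z^2 + z * w + w^2)"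

definition represents :: "int \<Rightarrow> int \<Rightarrow> int \<Rightarrow> bool" where
  "represents a b n \<longleftrightarrow> (\<exists>x y z w. f1 a b x y z w = n)"

end

theory Submission
  imports Defs "HOL-Analysis.Summation_Tests" "HOL-Number_Theory.Number_Theory"
    "HOL-Computational_Algebra.Squarefree"
begin

text \<open>
  The ternary forms \<open>a x\<^sup>2 + (z\<^sup>2 + z w + w\<^sup>2)\<close> with \<open>a = 1, 2\<close> represent every squarefree number
  \<open>m\<close> with \<open>m \<noteq> 6 (mod 9)\<close> resp. \<open>m \<noteq> 10 (mod 16)\<close>, and one or two values of \<open>y\<close> suffice to move
  the remaining numbers into the range of the ternary form. Both forms are Euclidean, so by the
  descent of Davenport and Cassels rational representations are enough. Over the rationals
  \<open>z\<^sup>2 + z w + w\<^sup>2\<close> is the norm form \<open>z\<^sup>2 + 3 w\<^sup>2\<close>, which represents every prime \<open>q = 1 (mod 3)\<close>.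
  Hence it is enough to find such a \<open>q\<close> for which \<open>a x\<^sup>2 + q y\<^sup>2 = m z\<^sup>2\<close> (or a variant with \<open>3 q\<close>) is
  solvable; by Legendre's theorem and quadratic reciprocity this only prescribes \<open>q\<close> modulo 8 and its
  quadratic characters modulo the odd primes dividing \<open>3 m\<close>. Since only quadratic conditions occur,
  the existence of \<open>q\<close> follows from \<open>L(1, \<chi>) \<noteq> 0\<close> for real characters \<open>\<chi>\<close>, for which Monsky's elementary
  argument and Mertens' method are available.
\<close>

section \<open>Primes with prescribed values of real characters\<close>

text \<open>Over the rationals, \<open>a x^2 + Z^2 + 3 W^2 = m T^2\<close> is a question about four
  squares, while Legendre's theorem handles three; the prime \<open>q\<close> is, up to squares, a
  common value of \<open>m T^2 - a x^2\<close> and \<open>Z^2 + 3 W^2\<close>, as in the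
  four-variable case of Hasse-Minkowski. The excluded classes are true local obstructions: if 3
  divides \<open>x^2 + z^2 + z w + w^2\<close>, then 3 divides \<open>x\<close> and
  \<open>z - w\<close>, which leaves \<open>3 w^2\<close> modulo 9, never 6; and 10 modulo 16 would
  require a norm with an odd power of 2, while an even norm has \<open>z\<close> and
  \<open>w\<close> even. Representability by the quaternary form survives multiplication by squares,
  so only squarefree targets matter, and for these each obstruction is one residue class, with least
  members 6 and 10. These are the upper bounds for \<open>b\<close>: a larger \<open>b\<close>
  cannot help at that number. At \<open>b = 6\<close> and \<open>b = 10\<close> themselves,
  \<open>y = 1\<close> leaves a multiple of 9 or 16 that may be obstructed again, and
  \<open>y = 2\<close> is the way out. Similarly 2, which is no norm, forces
  \<open>a \<le> 2\<close>.\<close>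

lemma sum_divisors_regroup:
  fixes g :: "nat \<Rightarrow> nat \<Rightarrow> 'a::comm_monoid_add"
  shows "(\<Sum>n\<in>{1..N}. \<Sum>d | d dvd n. g d (n div d)) = (\<Sum>d\<in>{1..N}. \<Sum>k\<in>{1..N div d}. g d k)"
proof -
  have aux: "b \<le> N" if "Suc 0 \<le> k" "b * k \<le> N" for b k
    using that by (metis One_nat_def le_trans mult.right_neutral mult_le_mono2)
  have "(\<Sum>n\<in>{1..N}. \<Sum>d | d dvd n. g d (n div d))
      = (\<Sum>(n,d)\<in>(SIGMA n:{1..N}. {d. d dvd n}). g d (n div d))"
    by (rule sum.Sigma) auto
  also have "\<dots> = (\<Sum>(d,k)\<in>(SIGMA d:{1..N}. {1..N div d}). g d k)"
    by (rule sum.reindex_bij_witness[where i="\<lambda>(d,k). (d*k,d)" and j="\<lambda>(n,d). (d, n div d)"])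
       (auto simp: less_eq_div_iff_mult_less_eq mult.commute dest: dvd_imp_le elim!: dvdE,
         blast intro: aux)
  also have "\<dots> = (\<Sum>d\<in>{1..N}. \<Sum>k\<in>{1..N div d}. g d k)"
    by (rule sum.Sigma[symmetric]) auto
  finally show ?thesis .
qed

section \<open>Chebyshev's upper bound for sums of \<open>mangoldt\<close>\<close>

lemma ln_fact_eq_sum_mangoldt:
  "ln (fact N :: real) = (\<Sum>d\<in>{1..N}. mangoldt d * real (N div d))"
proof -
  have "ln (fact N :: real) = (\<Sum>n\<in>{1..N}. ln (real n))"
    unfolding fact_prod by (subst of_nat_prod, subst ln_prod) auto
  also have "\<dots> = (\<Sum>n\<in>{1..N}. \<Sum>d | d dvd n. mangoldt d)"
    by (intro sum.cong) (auto simp: mangoldt_sum)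
  also have "\<dots> = (\<Sum>d\<in>{1..N}. \<Sum>k\<in>{1..N div d}. mangoldt d)"
    by (rule sum_divisors_regroup)
  finally show ?thesis by (simp add: mult.commute)
qed

text \<open>The weight \<open>2*N div d - 2 * (N div d)\<close> is nonnegative, and 1 for
  \<open>N < d \<le> 2*N\<close>; summed against \<open>mangoldt\<close> it gives the logarithm of
  the central binomial coefficient.\<close>

lemma sum_mangoldt_double_le:
  "(\<Sum>d\<in>{1..2*N}. mangoldt d :: real) - (\<Sum>d\<in>{1..N}. mangoldt d) \<le> 2 * real N"
proof -
  have ext: "ln (fact N :: real) = (\<Sum>d\<in>{1..2*N}. mangoldt d * real (N div d))"
    unfolding ln_fact_eq_sum_mangoldt by (rule sum.mono_neutral_left) auto
  have "(\<Sum>d\<in>{1..2*N}. mangoldt d :: real) - (\<Sum>d\<in>{1..N}. mangoldt d)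
      = (\<Sum>d\<in>{1..2*N}-{1..N}. mangoldt d)"
    by (rule sum_diff[symmetric]) auto
  also have "\<dots> = (\<Sum>d\<in>{1..2*N}. if d > N then mangoldt d else 0)"
    by (rule sum.mono_neutral_cong_left) auto
  also have "\<dots> \<le> (\<Sum>d\<in>{1..2*N}. mangoldt d * (real (2*N div d) - 2 * real (N div d)))"
  proof (rule sum_mono)
    fix d assume d: "d \<in> {1..2*N}"
    have "2 * (N div d) \<le> 2 * N div d"
      using d by (simp add: less_eq_div_iff_mult_less_eq mult.assoc)
    hence 1: "2 * real (N div d) \<le> real (2*N div d)"
      by (metis of_nat_le_iff of_nat_mult of_nat_numeral)
    have "1 \<le> 2*N div d" using d by (simp add: less_eq_div_iff_mult_less_eq)
    hence 2: "1 \<le> real (2*N div d)" by linarith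
    show "(if d > N then mangoldt d else 0)
      \<le> mangoldt d * (real (2*N div d) - 2 * real (N div d))"
    proof (cases "d > N")
      case True
      thus ?thesis using mult_left_mono[OF 2 mangoldt_nonneg[of d]] by simp
    next
      case False
      thus ?thesis using 1 by (simp add: mangoldt_nonneg)
    qed
  qed
  also have "\<dots> = ln (fact (2*N)) - 2 * ln (fact N)"
  proof -
    have "(\<Sum>d\<in>{1..2*N}. mangoldt d * (real (2*N div d) - 2 * real (N div d)))
        = (\<Sum>d\<in>{1..2*N}. mangoldt d * real (2*N div d) - 2 * (mangoldt d * real (N div d)))"
      by (intro sum.cong) (simp_all add: right_diff_distrib)
    thus ?thesis unfolding ln_fact_eq_sum_mangoldt[of "2*N"] ext
      by (simp add: sum_subtractf sum_distrib_left)
  qed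
  also have "\<dots> = ln (real (2*N choose N))"
  proof -
    have "real (2*N choose N) = fact (2*N) / (fact N * fact N)"
      using binomial_fact[of N "2*N", where ?'a = real] by (simp add: mult_2)
    thus ?thesis by (simp add: ln_div ln_mult)
  qed
  also have "\<dots> \<le> ln (2 ^ (2*N))"
  proof -
    have "(2*N choose N) \<le> 2 ^ (2*N)" by (rule binomial_le_pow2)
    hence "real (2*N choose N) \<le> 2 ^ (2*N)"
      by (metis of_nat_le_iff of_nat_power of_nat_numeral)
    thus ?thesis by simp
  qed
  also have "\<dots> \<le> 2 * real N"
    using ln_2_less_1 by (simp add: ln_realpow mult_left_le)
  finally show ?thesis .
qed

text \<open>Halving induction. An odd \<open>N = 2*K+1\<close> is rounded up to
  \<open>2 * (K+1)\<close>, and \<open>6 * (K+1) \<le> 4 * N\<close> holds because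
  \<open>K \<ge> 1\<close>.\<close>

lemma sum_mangoldt_le: "(\<Sum>d\<in>{1..N}. mangoldt d :: real) \<le> 4 * real N"
proof (induction N rule: less_induct)
  case (less N)
  consider "N = 0" | "N = 1" | K where "N = 2*K" "K \<ge> 1" | K where "N = 2*K+1" "K \<ge> 1"
    by (metis One_nat_def Suc_eq_plus1 add.commute evenE le_numeral_extra(4) less_one linorder_not_less mult_0_right oddE
        mult_eq_0_iff nat_neq_iff)
  thus ?case
  proof cases
    case (3 K)
    thus ?thesis using less.IH[of K] sum_mangoldt_double_le[of K] by simp
  next
    case (4 K)
    have "(\<Sum>d\<in>{1..N}. mangoldt d :: real) \<le> (\<Sum>d\<in>{1..2*(K+1)}. mangoldt d)"
      using 4 by (intro sum_mono2) (auto simp: mangoldt_nonneg)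
    also have "\<dots> \<le> 2 * real (K+1) + 4 * real (K+1)"
      using less.IH[of "K+1"] sum_mangoldt_double_le[of "K+1"] 4 by linarith
    finally show ?thesis using 4 by simp
  qed auto
qed

text \<open>Makes Monsky's weights nonnegative and decreasing. With
  \<open>1 - t^k = (1 - t) * S k\<close> the claims become \<open>n * t^n \<le> S n\<close> and
  \<open>n * (n+1) * t^n \<le> S n * S (n+1)\<close>, which follow from the arithmetic-geometric
  mean bound for \<open>S\<close>.\<close>

lemma power_over_geometric_le:
  fixes t :: real
  assumes "0 < t" "t < 1" "n > 0"
  shows "t ^ n / (1 - t ^ n) \<le> 1 / (real n * (1 - t))"
    and "1 / (real (Suc n) * (1 - t)) - t ^ Suc n / (1 - t ^ Suc n)
           \<le> 1 / (real n * (1 - t)) - t ^ n / (1 - t ^ n)"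
proof -
  define S where "S n = (\<Sum>i<n. t ^ i)" for n
  have geo: "1 - t ^ k = (1 - t) * S k" for k
    using sum_gp_strict[of t k] assms by (simp add: S_def)
  have am_gm: "S k \<ge> real k * sqrt t ^ (k - 1)" for k
  proof -
    define u where "u = sqrt t"
    have u: "t = u^2" "u \<ge> 0" using assms by (auto simp: u_def)
    \<comment> \<open>Adding the reversed sum pairs \<open>t^i\<close> with
      \<open>t^(k-1-i)\<close>, whose geometric mean \<open>sqrt t ^ (k-1)\<close> does not depend
      on \<open>i\<close>.\<close>
    have "2 * S k = (\<Sum>i<k. t ^ i) + (\<Sum>i<k. t ^ (k - Suc i))"
      using sum.nat_diff_reindex[of "\<lambda>i. t ^ i" k] by (simp add: S_def)
    also have "\<dots> = (\<Sum>i<k. (u^i)^2 + (u^(k - Suc i))^2)"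
      by (simp add: sum.distrib u flip: power_mult mult.commute)
    also have "\<dots> \<ge> (\<Sum>i<k. 2 * u ^ (k - 1))"
    proof (rule sum_mono)
      fix i assume "i \<in> {..<k}"
      hence "u ^ (k - 1) = u ^ i * u ^ (k - Suc i)" by (simp flip: power_add)
      thus "2 * u ^ (k - 1) \<le> (u^i)^2 + (u^(k - Suc i))^2"
        using sum_squares_bound[of "u^i" "u^(k - Suc i)"] by (simp add: mult.assoc)
    qed
    finally show ?thesis by (simp add: u_def)
  qed
  have st: "0 < sqrt t" "sqrt t < 1" using assms by auto
  have Spos: "S k > 0" if "k > 0" for k
    using that st by (intro less_le_trans[OF _ am_gm]) auto
  have sq: "t ^ n = sqrt t ^ (2 * n)" using assms by (simp add: power_mult)
  have "sqrt t ^ (2*n) \<le> sqrt t ^ (n - 1)" using st by (intro power_decreasing) auto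
  hence "real n * t ^ n \<le> real n * sqrt t ^ (n - 1)" by (simp add: sq mult_left_mono)
  also have "\<dots> \<le> S n" by (rule am_gm)
  finally show "t ^ n / (1 - t ^ n) \<le> 1 / (real n * (1 - t))"
    using assms Spos[of n] unfolding geo by (simp add: divide_simps mult.commute)
  have "t ^ n / (S n * S (Suc n)) \<le> 1 / (real n * real (Suc n))"
  proof -
    have "real n * real (Suc n) * t ^ n \<le> (real n * sqrt t ^ (n - 1)) * (real (Suc n) * sqrt t ^ n)"
    proof -
      have "sqrt t ^ (2*n) \<le> sqrt t ^ (n - 1 + n)" using st by (intro power_decreasing) auto
      hence "real n * real (Suc n) * t ^ n \<le> real n * real (Suc n) * (sqrt t ^ (n - 1) * sqrt t ^ n)"
        unfolding sq power_add by (intro mult_left_mono) auto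
      thus ?thesis by (simp add: mult_ac)
    qed
    also have "\<dots> \<le> S n * S (Suc n)"
      using am_gm[of n] am_gm[of "Suc n"] Spos[of n] assms st by (intro mult_mono) auto
    finally show ?thesis using Spos[of n] Spos[of "Suc n"] assms by (simp add: divide_simps mult_ac)
  qed
  hence "t ^ n / (S n * S (Suc n)) / (1 - t) \<le> 1 / (real n * real (Suc n)) / (1 - t)"
    using assms by (intro divide_right_mono) auto
  moreover have "t ^ n / (1 - t ^ n) - t ^ Suc n / (1 - t ^ Suc n) = t ^ n / (S n * S (Suc n)) / (1 - t)"
  proof -
    have "S (Suc n) - t * S n = 1" using sum_gp_strict[of t n] assms
      by (simp add: S_def field_simps)
    hence "t ^ n * (S (Suc n) - t * S n) = t ^ n" by simp
    hence "t ^ n * S (Suc n) - t ^ Suc n * S n = t ^ n" by (simp add: algebra_simps)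
    hence "t ^ n / (S n * S (Suc n)) = t ^ n / S n - t ^ Suc n / S (Suc n)"
      using Spos[of n] Spos[of "Suc n"] assms by (simp add: diff_frac_eq less_imp_neq[symmetric] mult.commute)
    thus ?thesis unfolding geo by (simp add: diff_divide_distrib mult.commute)
  qed
  moreover have "1 / (real n * (1 - t)) - 1 / (real (Suc n) * (1 - t)) = 1 / (real n * real (Suc n)) / (1 - t)"
  proof -
    have "1 / real n - 1 / real (Suc n) = 1 / (real n * real (Suc n))"
      using assms by (simp add: field_simps)
    thus ?thesis by (metis diff_divide_distrib divide_divide_eq_left)
  qed
  ultimately have "t ^ n / (1 - t ^ n) - t ^ Suc n / (1 - t ^ Suc n)
     \<le> 1 / (real n * (1 - t)) - 1 / (real (Suc n) * (1 - t))"
    by linarith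
  thus "1 / (real (Suc n) * (1 - t)) - t ^ Suc n / (1 - t ^ Suc n)
           \<le> 1 / (real n * (1 - t)) - t ^ n / (1 - t ^ n)" by linarith
qed

section \<open>Real characters, the nonvanishing of \<open>L1\<close>, and Mertens' estimate\<close>

text \<open>Nonprincipality is encoded by the vanishing sum over a period. Functions on
  \<open>nat\<close> instead of characters of a residue group let products of Legendre symbols be
  inserted directly.\<close>

locale nonprincipal_real_character =
  fixes \<psi> :: "nat \<Rightarrow> real" and M :: nat
  assumes modulus_pos: "M > 0"
    and one: "\<psi> (Suc 0) = 1"
    and mult: "\<psi> (a * b) = \<psi> a * \<psi> b"
    and periodic: "\<psi> (n + M) = \<psi> n"
    and char_values: "\<psi> n \<in> {-1, 0, 1}"
    and sum_period: "(\<Sum>n<M. \<psi> n) = 0"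
begin

lemma abs_le_1: "\<bar>\<psi> n\<bar> \<le> 1"
  using char_values[of n] by auto

lemma sum_shifted_period: "(\<Sum>k=a..<a+M. \<psi> k) = 0"
proof (induction a)
  case 0
  thus ?case using sum_period by (simp add: atLeast0LessThan)
next
  case (Suc a)
  have "(\<Sum>k=a..<a+M. \<psi> k) + \<psi> (a + M) = (\<Sum>k=a..<Suc (a+M). \<psi> k)" by simp
  also have "\<dots> = \<psi> a + (\<Sum>k=Suc a..<Suc (a+M). \<psi> k)"
    by (rule sum.atLeast_Suc_lessThan) simp
  finally show ?case using Suc periodic[of a] by simp
qed

text \<open>Full periods cancel, and fewer than \<open>M\<close> terms remain.\<close>

lemma abs_sum_le: "\<bar>\<Sum>k=a..<b. \<psi> k\<bar> \<le> real M"
proof (induction "b - a" arbitrary: a rule: less_induct)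
  case less
  show ?case
  proof (cases "a + M \<le> b")
    case True
    hence "(\<Sum>k=a..<b. \<psi> k) = (\<Sum>k=a+M..<b. \<psi> k)"
      using sum.atLeastLessThan_concat[of a "a+M" b \<psi>] sum_shifted_period[of a] by simp
    thus ?thesis using less[of "a + M"] True modulus_pos by simp
  next
    case False
    have "\<bar>\<Sum>k=a..<b. \<psi> k\<bar> \<le> (\<Sum>k=a..<b. 1)"
      by (rule order.trans[OF sum_abs]) (rule sum_mono, rule abs_le_1)
    also have "\<dots> \<le> real M" using False by simp
    finally show ?thesis .
  qed
qed

text \<open>Abel summation: the partial sums of \<open>\<psi>\<close> are bounded by
  \<open>M\<close>, and the decrements of \<open>f\<close> telescope.\<close>

lemma abs_sum_decreasing_le:
  assumes "\<And>n. a \<le> n \<Longrightarrow> f (Suc n) \<le> f n" "\<And>n. a \<le> n \<Longrightarrow> 0 \<le> f n"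
  shows "\<bar>\<Sum>k=a..<b. \<psi> k * f k\<bar> \<le> real M * f a"
proof (cases "a \<le> b")
  case True
  define P where "P n = (\<Sum>k=a..<n. \<psi> k)" for n
  have P: "\<bar>P n\<bar> \<le> real M" for n unfolding P_def by (rule abs_sum_le)
  have eq: "(\<Sum>k=a..<b. \<psi> k * f k) = P b * f b + (\<Sum>k=a..<b. P (Suc k) * (f k - f (Suc k)))"
    using True by (induction b rule: dec_induct) (auto simp: P_def algebra_simps)
  have "\<bar>\<Sum>k=a..<b. \<psi> k * f k\<bar> \<le> real M * f b + (\<Sum>k=a..<b. real M * (f k - f (Suc k)))"
    unfolding eq using assms True P
    by (intro order.trans[OF abs_triangle_ineq] add_mono order.trans[OF sum_abs] sum_mono)
       (auto simp: abs_mult intro!: mult_mono)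
  also have "(\<Sum>k=a..<b. real M * (f k - f (Suc k))) = real M * (f a - f b)"
    using sum_Suc_diff'[OF True, of "\<lambda>k. - f k"] by (simp flip: sum_distrib_left)
  finally show ?thesis by (simp add: algebra_simps)
qed (use assms in auto)

definition L1 :: real where "L1 = lim (\<lambda>N. \<Sum>k\<in>{1..N}. \<psi> k / real k)"

text \<open>Beyond convergence, the rate \<open>1 / (N+1)\<close> is what later keeps the total
  error over all arguments \<open>N div d\<close> bounded.\<close>

lemma sum_tail_le:
  assumes "N \<le> K"
  shows "\<bar>(\<Sum>k\<in>{1..K}. \<psi> k / real k) - (\<Sum>k\<in>{1..N}. \<psi> k / real k)\<bar> \<le> real M / real (Suc N)"
proof -
  have "(\<Sum>k\<in>{1..K}. \<psi> k / real k) - (\<Sum>k\<in>{1..N}. \<psi> k / real k) = (\<Sum>k=Suc N..<Suc K. \<psi> k * (1 / real k))"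
    using sum.atLeastLessThan_concat[of 1 "Suc N" "Suc K" "\<lambda>k. \<psi> k / real k"] assms
    by (simp add: atLeastLessThanSuc_atLeastAtMost)
  also have "\<bar>\<dots>\<bar> \<le> real M * (1 / real (Suc N))"
    by (rule abs_sum_decreasing_le) (auto simp: field_simps)
  finally show ?thesis by simp
qed

lemma tendsto_L1: "(\<lambda>N. \<Sum>k\<in>{1..N}. \<psi> k / real k) \<longlonglongrightarrow> L1"
proof -
  have "Cauchy (\<lambda>N. \<Sum>k\<in>{1..N}. \<psi> k / real k)"
  proof (rule CauchyI')
    fix e :: real assume "e > 0"
    obtain N :: nat where "real M / e < real N" using reals_Archimedean2 by blast
    hence N: "real M / real (Suc N) < e" using \<open>e > 0\<close> by (simp add: field_simps)
    show "\<exists>N. \<forall>m\<ge>N. \<forall>n>m. dist (\<Sum>k\<in>{1..m}. \<psi> k / real k) (\<Sum>k\<in>{1..n}. \<psi> k / real k) < e"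
    proof (intro exI allI impI)
      fix m n assume mn: "N \<le> m" "m < n"
      have "dist (\<Sum>k\<in>{1..m}. \<psi> k / real k) (\<Sum>k\<in>{1..n}. \<psi> k / real k) \<le> real M / real (Suc m)"
        using sum_tail_le[of m n] mn by (simp add: dist_real_def abs_minus_commute)
      also have "\<dots> \<le> real M / real (Suc N)" using mn by (simp add: frac_le)
      finally show "dist (\<Sum>k\<in>{1..m}. \<psi> k / real k) (\<Sum>k\<in>{1..n}. \<psi> k / real k) < e"
        using N by simp
    qed
  qed
  thus ?thesis unfolding L1_def by (simp add: Cauchy_convergent_iff convergent_LIMSEQ_iff)
qed

lemma L1_approx: "\<bar>(\<Sum>k\<in>{1..N}. \<psi> k / real k) - L1\<bar> \<le> real M / real (Suc N)"
proof -
  have "(\<lambda>K. \<bar>(\<Sum>k\<in>{1..K}. \<psi> k / real k) - (\<Sum>k\<in>{1..N}. \<psi> k / real k)\<bar>)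
          \<longlonglongrightarrow> \<bar>L1 - (\<Sum>k\<in>{1..N}. \<psi> k / real k)\<bar>"
    by (intro tendsto_intros tendsto_L1)
  from LIMSEQ_le_const2[OF this] have "\<bar>L1 - (\<Sum>k\<in>{1..N}. \<psi> k / real k)\<bar> \<le> real M / real (Suc N)"
    using sum_tail_le by blast
  thus ?thesis by simp
qed

text \<open>The divisor sum is multiplicative, and at a prime power it is a geometric sum of
  \<open>\<psi> p\<close>, which is -1, 0 or 1: such a sum is nonnegative, and at least 1 for an
  even exponent. The induction splits off one full prime power.\<close>

lemma divisor_sum_nonneg:
  assumes "n > 0"
  shows "(\<Sum>d | d dvd n. \<psi> d) \<ge> 0 \<and> (\<forall>k. n = k\<^sup>2 \<longrightarrow> (\<Sum>d | d dvd n. \<psi> d) \<ge> 1)"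
  using assms
proof (induction n rule: less_induct)
  case (less n)
  show ?case
  proof (cases "n = 1")
    case True
    hence "(\<Sum>d | d dvd n. \<psi> d) = 1" using one by simp
    thus ?thesis by (simp only: order_refl zero_le_one simp_thms)
  next
    case False
    then obtain p where p: "prime p" "p dvd n" using prime_factor_nat by blast
    define e where "e = multiplicity p n"
    obtain m where m: "n = p ^ e * m" "\<not> p dvd m"
      using multiplicity_decompose'[of n p] less.prems p
      unfolding e_def by (metis neq0_conv not_prime_unit)
    have e: "e > 0" using p less.prems by (simp add: e_def prime_multiplicity_gt_zero_iff)
    have "m > 0" using m less.prems by (cases m) auto
    have "m < n" using m e p \<open>m > 0\<close> prime_gt_1_nat[of p]
      by (metis One_nat_def mult.commute n_less_m_mult_n one_less_power)
    have cop: "coprime (p ^ e) m" using m p by (simp add: prime_imp_coprime)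
    have bij: "bij_betw (\<lambda>(i, d). p ^ i * d) ({..e} \<times> {d. d dvd m}) {d. d dvd n}"
      unfolding bij_betw_def
    proof
        show "inj_on (\<lambda>(i, d). p ^ i * d) ({..e} \<times> {d. d dvd m})"
        proof (rule inj_onI, clarify)
          fix i d j c assume *: "d dvd m" "c dvd m" "p ^ i * d = p ^ j * c"
          have nd: "\<not> p dvd d" "\<not> p dvd c" using * m dvd_trans by blast+
          have "multiplicity p (p ^ i * d) = i" "multiplicity p (p ^ j * c) = j"
            using nd p by (auto intro!: multiplicity_eqI)
          thus "i = j \<and> d = c" using * p by (auto simp: prime_gt_0_nat)
        qed
        show "(\<lambda>(i, d). p ^ i * d) ` ({..e} \<times> {d. d dvd m}) = {d. d dvd n}"
        proof (intro equalityI subsetI)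
          fix d assume "d \<in> {d. d dvd n}"
          hence "d dvd p ^ e * m" using m by simp
          then obtain a b where "d = a * b" "a dvd p ^ e" "b dvd m" by (metis division_decomp)
          moreover then obtain i where "i \<le> e" "a = p ^ i" using divides_primepow_nat[OF p(1)] by blast
          ultimately show "d \<in> (\<lambda>(i, d). p ^ i * d) ` ({..e} \<times> {d. d dvd m})" by force
        qed (auto simp: m intro!: mult_dvd_mono le_imp_power_dvd)
    qed
    have "(\<Sum>d | d dvd n. \<psi> d) = (\<Sum>(i,d)\<in>{..e} \<times> {d. d dvd m}. \<psi> (p ^ i * d))"
      using sum.reindex_bij_betw[OF bij, of \<psi>] by (simp add: case_prod_unfold)
    also have "\<dots> = (\<Sum>i\<le>e. \<psi> p ^ i) * (\<Sum>d | d dvd m. \<psi> d)"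
    proof -
      have "\<psi> (p ^ i) = \<psi> p ^ i" for i by (induction i) (auto simp: one mult)
      thus ?thesis by (simp add: mult sum_product sum.cartesian_product)
    qed
    finally have eq: "(\<Sum>d | d dvd n. \<psi> d) = (\<Sum>i\<le>e. \<psi> p ^ i) * (\<Sum>d | d dvd m. \<psi> d)" .
    have alt: "(\<Sum>i\<le>k. (-1::real) ^ i) = (if even k then 1 else 0)" for k by (induction k) auto
    have z: "(\<Sum>i\<le>k. (0::real) ^ i) = 1" for k by (induction k) auto
    have ge0: "(\<Sum>i\<le>e. \<psi> p ^ i) \<ge> 0"
      using char_values[of p] by (auto simp: alt z)
    have ge1: "(\<Sum>i\<le>e. \<psi> p ^ i) \<ge> 1" if "even e"
      using char_values[of p] that by (auto simp: alt z)
    note IH = less.IH[OF \<open>m < n\<close> \<open>m > 0\<close>]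
    show ?thesis
    proof (intro conjI allI impI)
      show "(\<Sum>d | d dvd n. \<psi> d) \<ge> 0" unfolding eq using IH ge0 by simp
    next
      fix k assume k: "n = k\<^sup>2"
      have "k \<noteq> 0" using k less.prems by auto
      hence e2: "e = 2 * multiplicity p k"
        unfolding e_def k using p by (simp add: prime_elem_multiplicity_power_distrib)
      hence ev: "even e" by simp
      have "p ^ (2 * multiplicity p k) * m = k\<^sup>2" using k m e2 by simp
      moreover obtain k' where k': "k = p ^ multiplicity p k * k'"
        using multiplicity_dvd[of p k] by (auto elim: dvdE)
      hence "k\<^sup>2 = p ^ (2 * multiplicity p k) * k'\<^sup>2"
        by (metis power_mult power_mult_distrib mult.commute)
      ultimately have "m = k'\<^sup>2" using p by (simp add: prime_gt_0_nat)
      with IH have "(\<Sum>d | d dvd m. \<psi> d) \<ge> 1" by simp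
      from mult_mono[OF ge1[OF ev] this] show "(\<Sum>d | d dvd n. \<psi> d) \<ge> 1"
        unfolding eq using ge0 by simp
    qed
  qed
qed

text \<open>Monsky's argument: if \<open>L(1) = 0\<close>, then subtracting \<open>\<psi> n / (n (1 - t))\<close> from the terms of the Lambert
  series \<open>\<Sum> \<psi> n t\<^sup>n / (1 - t\<^sup>n)\<close> turns it into a series with decreasing weights, so it stays bounded as
  \<open>t\<close> tends to 1. But it equals \<open>\<Sum> (\<Sum>d | d dvd n. \<psi> d) t\<^sup>n\<close>, which dominates the sum of \<open>t ^ (k\<^sup>2)\<close> over all \<open>k\<close>.\<close>

lemma L1_nonzero: "L1 \<noteq> 0"
proof
  assume L0: "L1 = 0"
  \<comment> \<open>For fixed \<open>t\<close> the comparison uses finite sums up to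
    \<open>N\<close>; the limit in \<open>N\<close> removes the truncation errors and turns
    \<open>A N\<close> into \<open>L1 = 0\<close>. Only afterwards does \<open>t\<close> tend to
    1.\<close>
  have bound: "(\<Sum>k\<in>{1..K}. t ^ (k\<^sup>2)) \<le> real M" if t: "0 < t" "t < 1" for t :: real and K :: nat
  proof -
    define b where "b n = 1 / (real n * (1 - t)) - t ^ n / (1 - t ^ n)" for n
    define A where "A N = (\<Sum>k\<in>{1..N}. \<psi> k / real k)" for N
    have absb: "\<bar>\<Sum>n\<in>{1..N}. \<psi> n * b n\<bar> \<le> real M" for N
    proof -
      have "\<bar>\<Sum>n=1..<Suc N. \<psi> n * b n\<bar> \<le> real M * b 1"
        by (rule abs_sum_decreasing_le)
           (use power_over_geometric_le[OF t] in \<open>auto simp: b_def\<close>)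
      moreover have "b 1 = 1" using t by (simp add: b_def flip: diff_divide_distrib)
      ultimately show ?thesis by (simp add: atLeastLessThanSuc_atLeastAtMost)
    qed
    have key: "(\<Sum>k\<in>{1..K}. t ^ (k\<^sup>2)) \<le> A N / (1 - t) + real M + real N * t ^ N / (1 - t)"
      if N: "N \<ge> K\<^sup>2" for N
    proof -
      have inj: "inj_on (\<lambda>k::nat. k\<^sup>2) {1..K}" by (auto simp: inj_on_def power2_eq_iff_nonneg)
      have sub: "(\<lambda>k::nat. k\<^sup>2) ` {1..K} \<subseteq> {1..N}"
      proof
        fix j assume "j \<in> (\<lambda>k::nat. k\<^sup>2) ` {1..K}"
        then obtain k where k: "j = k\<^sup>2" "1 \<le> k" "k \<le> K" by auto
        have "k\<^sup>2 \<le> K\<^sup>2" using k by (intro power_mono) auto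
        from order.trans[OF this N] show "j \<in> {1..N}" using k by simp
      qed
      have "(\<Sum>k\<in>{1..K}. t ^ (k\<^sup>2)) = (\<Sum>j\<in>(\<lambda>k. k\<^sup>2) ` {1..K}. t ^ j)"
        by (subst sum.reindex[OF inj]) simp
      also have "\<dots> \<le> (\<Sum>j\<in>(\<lambda>k. k\<^sup>2) ` {1..K}. (\<Sum>d | d dvd j. \<psi> d) * t ^ j)"
      proof (rule sum_mono)
        fix j assume "j \<in> (\<lambda>k::nat. k\<^sup>2) ` {1..K}"
        hence "(\<Sum>d | d dvd j. \<psi> d) \<ge> 1" using divisor_sum_nonneg[of j] by auto
        thus "t ^ j \<le> (\<Sum>d | d dvd j. \<psi> d) * t ^ j"
          using t mult_right_mono[of 1 "(\<Sum>d | d dvd j. \<psi> d)" "t ^ j"] by simp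
      qed
      also have "\<dots> \<le> (\<Sum>j\<in>{1..N}. (\<Sum>d | d dvd j. \<psi> d) * t ^ j)"
        using t divisor_sum_nonneg by (intro sum_mono2 sub) auto
      also have "\<dots> = (\<Sum>j\<in>{1..N}. \<Sum>d | d dvd j. \<psi> d * t ^ (d * (j div d)))"
        by (intro sum.cong refl) (simp add: sum_distrib_right)
      also have "\<dots> = (\<Sum>d\<in>{1..N}. \<Sum>k\<in>{1..N div d}. \<psi> d * t ^ (d * k))"
        by (rule sum_divisors_regroup)
      \<comment> \<open>The full geometric series \<open>t^d / (1 - t^d)\<close> equals
        \<open>1 / (d * (1 - t)) - b d\<close>; cutting it after \<open>N div d\<close> terms costs
        at most \<open>t^N / (1 - t)\<close>, since
        \<open>d * (N div d + 1) \<ge> N\<close>.\<close>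
      also have "\<dots> \<le> (\<Sum>d\<in>{1..N}. \<psi> d / real d / (1 - t) - \<psi> d * b d + t ^ N / (1 - t))"
      proof (rule sum_mono)
        fix d assume d: "d \<in> {1..N}"
        define m where "m = N div d"
        have td: "0 < t ^ d" "t ^ d < 1" "t ^ d \<le> t"
          using t d by (auto simp: power_less_one_iff intro: power_decreasing[of 1 d t, simplified])
        have "(1 - t ^ d) * (\<Sum>k\<in>{1..m}. t ^ (d * k)) = t ^ d - t ^ (d * Suc m)"
        proof (induction m)
          case (Suc m)
          have "(1 - t ^ d) * (\<Sum>k\<in>{1..Suc m}. t ^ (d * k))
              = (1 - t ^ d) * (\<Sum>k\<in>{1..m}. t ^ (d * k)) + (1 - t ^ d) * t ^ (d * Suc m)"
            by (simp add: distrib_left)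
          also have "\<dots> = t ^ d - t ^ (d * Suc m) + (t ^ (d * Suc m) - t ^ d * t ^ (d * Suc m))"
            unfolding Suc.IH by (simp only: left_diff_distrib mult_1_left)
          also have "t ^ d * t ^ (d * Suc m) = t ^ (d * Suc (Suc m))"
            by (simp only: power_add[symmetric] mult_Suc_right)
          finally show ?case by simp
        qed simp
        hence eq: "(\<Sum>k\<in>{1..m}. t ^ (d * k)) = t ^ d / (1 - t ^ d) - t ^ (d * Suc m) / (1 - t ^ d)"
          using td(2) by (metis nonzero_mult_div_cancel_left diff_divide_distrib eq_iff_diff_eq_0 less_irrefl)
        have "N = d * (N div d) + N mod d" "N mod d < d" using d by auto
        hence "N \<le> d * Suc m" unfolding mult_Suc_right m_def by linarith
        hence tN: "t ^ (d * Suc m) \<le> t ^ N" using t by (intro power_decreasing) auto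
        have "t ^ (d * Suc m) / (1 - t ^ d) \<le> t ^ N / (1 - t)"
          using td tN t by (intro frac_le) auto
        moreover have "0 \<le> t ^ (d * Suc m) / (1 - t ^ d)" using td t by simp
        ultimately have err: "\<bar>\<psi> d * (t ^ (d * Suc m) / (1 - t ^ d))\<bar> \<le> t ^ N / (1 - t)"
          using abs_le_1[of d] unfolding abs_mult by (metis abs_of_nonneg mult_left_le_one_le order_trans abs_ge_zero)
        have "(\<Sum>k\<in>{1..m}. \<psi> d * t ^ (d * k)) = \<psi> d * (t ^ d / (1 - t ^ d)) - \<psi> d * (t ^ (d * Suc m) / (1 - t ^ d))"
          by (simp only: eq right_diff_distrib flip: sum_distrib_left)
        also have "\<psi> d * (t ^ d / (1 - t ^ d)) = \<psi> d / real d / (1 - t) - \<psi> d * b d"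
          by (simp add: b_def right_diff_distrib)
        finally show "(\<Sum>k\<in>{1..N div d}. \<psi> d * t ^ (d * k)) \<le> \<psi> d / real d / (1 - t) - \<psi> d * b d + t ^ N / (1 - t)"
          using err unfolding m_def by linarith
      qed
      also have "\<dots> = A N / (1 - t) - (\<Sum>d\<in>{1..N}. \<psi> d * b d) + real N * t ^ N / (1 - t)"
        by (simp add: sum.distrib sum_subtractf A_def sum_divide_distrib)
      finally show ?thesis using absb[of N] by linarith
    qed
    have "(\<lambda>N. A N / (1 - t) + real M + real N * t ^ N / (1 - t)) \<longlonglongrightarrow> L1 / (1 - t) + real M + 0 / (1 - t)"
      unfolding A_def using t by (intro tendsto_intros tendsto_L1 powser_times_n_limit_0) auto
    thus ?thesis using key unfolding L0 by (intro LIMSEQ_le_const) auto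
  qed
  \<comment> \<open>As \<open>t\<close> tends to 1 the left side tends to the number
    \<open>K\<close> of squares, while the bound does not depend on \<open>K\<close>.\<close>
  have "real K \<le> real M" for K :: nat
  proof (rule tendsto_upperbound)
    have "((\<lambda>t::real. \<Sum>k\<in>{1..K}. t ^ (k\<^sup>2)) \<longlongrightarrow> (\<Sum>k\<in>{1..K}. 1 ^ (k\<^sup>2))) (at_left 1)"
      by (intro tendsto_intros)
    thus "((\<lambda>t::real. \<Sum>k\<in>{1..K}. t ^ (k\<^sup>2)) \<longlongrightarrow> real K) (at_left 1)" by simp
    show "\<forall>\<^sub>F t in at_left 1. (\<Sum>k\<in>{1..K}. t ^ (k\<^sup>2)) \<le> real M"
      using eventually_at_left_real[of 0 "1::real"] by (auto elim!: eventually_mono intro!: bound[simplified])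
  qed auto
  from this[of "Suc M"] show False by simp
qed

text \<open>\<open>ln n / n\<close> decreases only from 3 on, so the terms 1 and 2 are split off
  before Abel summation.\<close>

lemma sum_ln_bounded: "\<exists>C. \<forall>N. \<bar>\<Sum>n\<in>{1..N}. \<psi> n * (ln (real n) / real n)\<bar> \<le> C"
proof (intro exI allI)
  fix N :: nat
  let ?f = "\<lambda>n. ln (real n) / real n"
  have dec: "?f (Suc n) \<le> ?f n" if "3 \<le> n" for n
  proof -
    have "ln (real (Suc n)) - ln (real n) \<le> 1 / real n"
      using ln_diff_le[of "real (Suc n)" "real n"] that by simp
    moreover have "1 \<le> ln (real n)"
      using exp_le that by (subst ln_ge_iff) auto
    ultimately have "real n * ln (real (Suc n)) \<le> real n * ln (real n) + ln (real n)"
      using that by (simp add: field_simps)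
    thus ?thesis using that by (simp add: field_simps)
  qed
  have small: "\<bar>\<Sum>n\<in>{1..K}. \<psi> n * ?f n\<bar> \<le> (\<Sum>n\<in>{1..2}. \<bar>\<psi> n * ?f n\<bar>)" if "K \<le> 2" for K :: nat
    using that by (intro order.trans[OF sum_abs] sum_mono2) auto
  show "\<bar>\<Sum>n\<in>{1..N}. \<psi> n * ?f n\<bar> \<le> (\<Sum>n\<in>{1..2}. \<bar>\<psi> n * ?f n\<bar>) + real M * ?f 3"
  proof (cases "N \<le> 2")
    case True
    have "0 \<le> real M * ?f 3" by simp
    thus ?thesis using small[OF True] by linarith
  next
    case False
    have "(\<Sum>n\<in>{1..N}. \<psi> n * ?f n) = (\<Sum>n\<in>{1..2}. \<psi> n * ?f n) + (\<Sum>n=3..<Suc N. \<psi> n * ?f n)"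
    proof -
      have "{1..N} = {1..2} \<union> {3..<Suc N}" using False by auto
      hence "(\<Sum>n\<in>{1..N}. \<psi> n * ?f n) = (\<Sum>n\<in>{1..2} \<union> {3..<Suc N}. \<psi> n * ?f n)"
        by (simp only:)
      also have "\<dots> = (\<Sum>n\<in>{1..2}. \<psi> n * ?f n) + (\<Sum>n=3..<Suc N. \<psi> n * ?f n)"
        by (rule sum.union_disjoint) auto
      finally show ?thesis .
    qed
    moreover have "\<bar>\<Sum>n=3..<Suc N. \<psi> n * ?f n\<bar> \<le> real M * ?f 3"
    proof -
      have "\<bar>\<Sum>n=3..<Suc N. \<psi> n * ?f n\<bar> \<le> real M * ?f (3::nat)"
        by (rule abs_sum_decreasing_le) (use dec in auto)
      thus ?thesis by simp
    qed
    ultimately show ?thesis using small[of 2] by linarith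
  qed
qed

text \<open>Mertens' method: \<open>\<psi> n * ln n / n\<close> is the convolution of
  \<open>\<psi> d * mangoldt d / d\<close> with \<open>\<psi> k / k\<close>. Replacing the inner
  partial sum by \<open>L1\<close> costs at most \<open>M * mangoldt d / N\<close> for each
  \<open>d\<close>, in total \<open>4 * M\<close> by Chebyshev's bound; then one divides by the
  nonzero \<open>L1\<close>.\<close>

lemma sum_mangoldt_bounded: "\<exists>C. \<forall>N. \<bar>\<Sum>d\<in>{1..N}. \<psi> d * (mangoldt d / real d)\<bar> \<le> C"
proof -
  obtain C where C: "\<And>N. \<bar>\<Sum>n\<in>{1..N}. \<psi> n * (ln (real n) / real n)\<bar> \<le> C"
    using sum_ln_bounded by blast
  define A where "A N = (\<Sum>k\<in>{1..N}. \<psi> k / real k)" for N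
  have "\<bar>\<Sum>d\<in>{1..N}. \<psi> d * (mangoldt d / real d)\<bar> \<le> (C + 4 * real M) / \<bar>L1\<bar>" for N
  proof (cases "N = 0")
    case True
    thus ?thesis using C[of 0] by simp
  next
    case False
    have "(\<Sum>n\<in>{1..N}. \<psi> n * (ln (real n) / real n))
        = (\<Sum>n\<in>{1..N}. \<Sum>d | d dvd n. \<psi> d * (mangoldt d / real d) * (\<psi> (n div d) / real (n div d)))"
    proof (rule sum.cong[OF refl])
      fix n assume n: "n \<in> {1..N}"
      have "\<psi> n * (ln (real n) / real n) = (\<Sum>d | d dvd n. \<psi> n / real n * mangoldt d)"
        unfolding sum_distrib_left[symmetric] using n mangoldt_sum[of n, where ?'a = real] by simp
      also have "\<dots> = (\<Sum>d | d dvd n. \<psi> d * (mangoldt d / real d) * (\<psi> (n div d) / real (n div d)))"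
      proof (rule sum.cong[OF refl])
        fix d assume "d \<in> {d. d dvd n}"
        then obtain k where k: "n = d * k" by auto
        thus "\<psi> n / real n * mangoldt d = \<psi> d * (mangoldt d / real d) * (\<psi> (n div d) / real (n div d))"
          using n by (simp add: mult)
      qed
      finally show "\<psi> n * (ln (real n) / real n) = \<dots>" .
    qed
    also have "\<dots> = (\<Sum>d\<in>{1..N}. \<Sum>k\<in>{1..N div d}. \<psi> d * (mangoldt d / real d) * (\<psi> k / real k))"
      by (rule sum_divisors_regroup)
    also have "\<dots> = (\<Sum>d\<in>{1..N}. \<psi> d * (mangoldt d / real d) * A (N div d))"
      by (simp add: A_def sum_distrib_left)
    also have "\<dots> = (\<Sum>d\<in>{1..N}. \<psi> d * (mangoldt d / real d)) * L1
         + (\<Sum>d\<in>{1..N}. \<psi> d * (mangoldt d / real d) * (A (N div d) - L1))"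
      by (simp add: right_diff_distrib sum_subtractf sum_distrib_right)
    finally have eq: "(\<Sum>d\<in>{1..N}. \<psi> d * (mangoldt d / real d)) * L1
        = (\<Sum>n\<in>{1..N}. \<psi> n * (ln (real n) / real n))
         - (\<Sum>d\<in>{1..N}. \<psi> d * (mangoldt d / real d) * (A (N div d) - L1))" by simp
    have "\<bar>\<Sum>d\<in>{1..N}. \<psi> d * (mangoldt d / real d) * (A (N div d) - L1)\<bar>
        \<le> (\<Sum>d\<in>{1..N}. mangoldt d * (real M / real N))"
    proof (rule order.trans[OF sum_abs], rule sum_mono)
      fix d assume d: "d \<in> {1..N}"
      have "N = d * (N div d) + N mod d" "N mod d < d" using d by auto
      hence "N \<le> d * Suc (N div d)" unfolding mult_Suc_right by linarith
      hence Nd: "real N \<le> real d * real (Suc (N div d))" by (metis of_nat_le_iff of_nat_mult)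
      have "\<bar>\<psi> d * (mangoldt d / real d) * (A (N div d) - L1)\<bar>
          = \<bar>\<psi> d\<bar> * (mangoldt d / real d * \<bar>A (N div d) - L1\<bar>)"
        by (simp add: abs_mult mangoldt_nonneg)
      also have "\<dots> \<le> 1 * (mangoldt d / real d * (real M / real (Suc (N div d))))"
        using abs_le_1 L1_approx[of "N div d", folded A_def]
        by (intro mult_mono mult_nonneg_nonneg) (auto simp: mangoldt_nonneg)
      also have "\<dots> = mangoldt d * (real M / (real d * real (Suc (N div d))))" by simp
      also have "\<dots> \<le> mangoldt d * (real M / real N)"
        using Nd False by (intro mult_left_mono divide_left_mono) (auto simp: mangoldt_nonneg)
      finally show "\<bar>\<psi> d * (mangoldt d / real d) * (A (N div d) - L1)\<bar> \<le> mangoldt d * (real M / real N)" .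
    qed
    also have "\<dots> = (\<Sum>d\<in>{1..N}. mangoldt d) * (real M / real N)" by (simp only: sum_distrib_right)
    also have "\<dots> \<le> (4 * real N) * (real M / real N)"
      by (intro mult_right_mono sum_mangoldt_le) auto
    also have "\<dots> = 4 * real M" using False by simp
    finally have "\<bar>(\<Sum>d\<in>{1..N}. \<psi> d * (mangoldt d / real d)) * L1\<bar> \<le> C + 4 * real M"
      unfolding eq using C[of N] by linarith
    thus ?thesis using L1_nonzero by (simp add: abs_mult field_simps)
  qed
  thus ?thesis by blast
qed

end

text \<open>If \<open>C\<close> were a bound, the same convolution would bound the sum of
  \<open>ln n / n\<close> over \<open>n\<close> coprime to \<open>M\<close> by \<open>C\<close>
  times the sum of \<open>1 / n\<close>. The terms with \<open>ln n \<ge> C + 1\<close> then bound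
  the latter sum too, although the numbers \<open>M * j + 1\<close> alone make it diverge.\<close>

lemma sum_coprime_mangoldt_unbounded:
  assumes M: "M > 0"
  shows "\<exists>N. (\<Sum>d\<in>{1..N}. of_bool (coprime d M) * (mangoldt d / real d)) > (C :: real)"
proof (rule ccontr)
  assume "\<not> ?thesis"
  hence le: "(\<Sum>d\<in>{1..N}. of_bool (coprime d M) * (mangoldt d / real d)) \<le> C" for N
    by (metis not_le)
  define c :: "nat \<Rightarrow> real" where "c n = of_bool (coprime n M)" for n
  have c: "c n \<ge> 0" "c n \<le> 1" "c (m * n) = c m * c n" for m n
    by (auto simp: c_def)
  define B where "B N = (\<Sum>k\<in>{1..N}. c k / real k)" for N
  have B: "B m \<le> B n" if "m \<le> n" for m n
    unfolding B_def using that c by (intro sum_mono2) auto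
  have le_CB: "(\<Sum>n\<in>{1..N}. c n / real n * ln (real n)) \<le> C * B N" for N
  proof -
    have "(\<Sum>n\<in>{1..N}. c n / real n * ln (real n))
        = (\<Sum>n\<in>{1..N}. \<Sum>d | d dvd n. c d * (mangoldt d / real d) * (c (n div d) / real (n div d)))"
    proof (rule sum.cong[OF refl])
      fix n assume n: "n \<in> {1..N}"
      have "c n / real n * ln (real n) = (\<Sum>d | d dvd n. c n / real n * mangoldt d)"
        unfolding sum_distrib_left[symmetric] using n mangoldt_sum[of n, where ?'a = real] by simp
      also have "\<dots> = (\<Sum>d | d dvd n. c d * (mangoldt d / real d) * (c (n div d) / real (n div d)))"
      proof (rule sum.cong[OF refl])
        fix d assume "d \<in> {d. d dvd n}"
        then obtain k where k: "n = d * k" by auto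
        thus "c n / real n * mangoldt d = c d * (mangoldt d / real d) * (c (n div d) / real (n div d))"
          using n c(3)[of d k] by simp
      qed
      finally show "c n / real n * ln (real n) = \<dots>" .
    qed
    also have "\<dots> = (\<Sum>d\<in>{1..N}. \<Sum>k\<in>{1..N div d}. c d * (mangoldt d / real d) * (c k / real k))"
      by (rule sum_divisors_regroup)
    also have "\<dots> = (\<Sum>d\<in>{1..N}. c d * (mangoldt d / real d) * B (N div d))"
      by (simp add: B_def sum_distrib_left)
    also have "\<dots> \<le> (\<Sum>d\<in>{1..N}. c d * (mangoldt d / real d) * B N)"
      using c by (intro sum_mono mult_left_mono B mult_nonneg_nonneg) (auto simp: mangoldt_nonneg)
    also have "\<dots> = (\<Sum>d\<in>{1..N}. c d * (mangoldt d / real d)) * B N"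
      by (simp only: sum_distrib_right)
    also have "\<dots> \<le> C * B N"
      using le[of N] c by (intro mult_right_mono) (auto simp: c_def[symmetric] B_def intro!: sum_nonneg)
    finally show ?thesis .
  qed
  obtain m :: nat where "exp (C + 1) < real m" using reals_Archimedean2 by blast
  moreover from this have "m > 0" using exp_gt_zero[of "C+1"] by (cases m) auto
  ultimately have m: "C + 1 \<le> ln (real n)" if "n \<ge> m" for n
    using that by (subst ln_ge_iff) auto
  define D where "D = (\<Sum>n\<in>{1..m}. c n / real n * \<bar>ln (real n) - C\<bar>) + B m"
  have B_le: "B N \<le> D" for N
  proof (cases "m \<le> N")
    case True
    have split: "(\<Sum>n\<in>{1..N}. g n) = (\<Sum>n\<in>{1..m}. g n) + (\<Sum>n\<in>{m<..N}. g n)" for g :: "nat \<Rightarrow> real"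
    proof -
      have "{1..N} = {1..m} \<union> {m<..N}" using True \<open>m > 0\<close> by auto
      hence "(\<Sum>n\<in>{1..N}. g n) = (\<Sum>n\<in>{1..m} \<union> {m<..N}. g n)" by (simp only:)
      also have "\<dots> = (\<Sum>n\<in>{1..m}. g n) + (\<Sum>n\<in>{m<..N}. g n)"
        by (rule sum.union_disjoint) auto
      finally show ?thesis .
    qed
    have "B N - B m = (\<Sum>n\<in>{m<..N}. c n / real n)"
      unfolding B_def by (subst split) simp
    also have "\<dots> \<le> (\<Sum>n\<in>{m<..N}. c n / real n * (ln (real n) - C))"
    proof (rule sum_mono)
      fix n assume "n \<in> {m<..N}"
      thus "c n / real n \<le> c n / real n * (ln (real n) - C)"
        using mult_left_mono[of 1 "ln (real n) - C" "c n / real n"] m[of n] c by simp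
    qed
    also have "\<dots> = (\<Sum>n\<in>{1..N}. c n / real n * (ln (real n) - C)) - (\<Sum>n\<in>{1..m}. c n / real n * (ln (real n) - C))"
      by (subst split) simp
    finally have 1: "B N - B m \<le> (\<Sum>n\<in>{1..N}. c n / real n * (ln (real n) - C))
       - (\<Sum>n\<in>{1..m}. c n / real n * (ln (real n) - C))" .
    have 2: "(\<Sum>n\<in>{1..N}. c n / real n * (ln (real n) - C)) \<le> 0"
    proof -
      have "(\<Sum>n\<in>{1..N}. c n / real n * (ln (real n) - C))
          = (\<Sum>n\<in>{1..N}. c n / real n * ln (real n)) - C * B N"
        unfolding B_def sum_distrib_left sum_subtractf[symmetric]
        by (intro sum.cong refl) (simp add: right_diff_distrib diff_divide_distrib mult_ac)
      thus ?thesis using le_CB[of N] by simp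
    qed
    have 3: "- (\<Sum>n\<in>{1..m}. c n / real n * (ln (real n) - C)) \<le> (\<Sum>n\<in>{1..m}. c n / real n * \<bar>ln (real n) - C\<bar>)"
    proof -
      have "- (\<Sum>n\<in>{1..m}. c n / real n * (ln (real n) - C)) = (\<Sum>n\<in>{1..m}. c n / real n * (C - ln (real n)))"
        unfolding sum_negf[symmetric] by (intro sum.cong refl) (simp add: right_diff_distrib diff_divide_distrib)
      also have "\<dots> \<le> (\<Sum>n\<in>{1..m}. c n / real n * \<bar>ln (real n) - C\<bar>)"
        using c by (intro sum_mono mult_left_mono) auto
      finally show ?thesis .
    qed
    show ?thesis using 1 2 3 unfolding D_def by linarith
  next
    case False
    have "B N \<le> B m" using False by (intro B) auto
    also have "\<dots> \<le> D" using c by (simp add: D_def sum_nonneg)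
    finally show ?thesis .
  qed
  have "(\<Sum>j<J. inverse (real (Suc j))) \<le> real M * D" for J
  proof -
    have aux: "inverse a \<le> k * (1 / b)" if "b \<le> k * a" "a > 0" "b > 0" for a b k :: real
      using that by (simp add: field_simps)
    have "(\<Sum>j<J. inverse (real (Suc j))) \<le> (\<Sum>j<J. real M * (1 / real (M * j + 1)))"
    proof (rule sum_mono)
      fix j
      have "M * j + 1 \<le> M * Suc j" using M by simp
      hence "real (M * j + 1) \<le> real M * real (Suc j)" by (metis of_nat_le_iff of_nat_mult)
      thus "inverse (real (Suc j)) \<le> real M * (1 / real (M * j + 1))"
        using M by (intro aux) (auto intro: add_pos_nonneg)
    qed
    also have "\<dots> = real M * (\<Sum>n\<in>(\<lambda>j. M * j + 1) ` {..<J}. 1 / real n)"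
      using M by (subst sum.reindex) (auto simp: inj_on_def sum_distrib_left)
    also have "(\<Sum>n\<in>(\<lambda>j. M * j + 1) ` {..<J}. 1 / real n) = (\<Sum>n\<in>(\<lambda>j. M * j + 1) ` {..<J}. c n / real n)"
    proof (intro sum.cong refl)
      fix n assume "n \<in> (\<lambda>j. M * j + 1) ` {..<J}"
      then obtain j where n: "n = M * j + 1" by auto
      have "coprime n M"
        unfolding n by (rule coprimeI) (metis dvd_add_right_iff dvd_mult2)
      thus "1 / real n = c n / real n" by (simp add: c_def)
    qed
    also have "\<dots> \<le> B (M * J)"
      unfolding B_def
    proof (intro sum_mono2)
      show "(\<lambda>j. M * j + 1) ` {..<J} \<subseteq> {1..M * J}"
      proof safe
        fix j assume "j < J"
        hence "M * Suc j \<le> M * J" by (intro mult_le_mono2) auto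
        thus "M * j + 1 \<in> {1..M * J}" using M by simp
      qed
    qed (use c in auto)
    also have "\<dots> \<le> D" by (rule B_le)
    finally show ?thesis using M by (simp add: mult_left_mono)
  qed
  hence "summable (\<lambda>j. inverse (real (Suc j)))"
    by (intro summableI_nonneg_bounded) auto
  thus False using not_summable_harmonic[where ?'a = real] summable_Suc_iff[of "\<lambda>n. inverse (real n)"] by simp
qed

text \<open>Serves to bound the share of even prime powers \<open>e^2\<close>; the comparison is
  \<open>ln e \<le> 2 * e powr (1/2)\<close>.\<close>

lemma sum_ln_over_square_bounded: "\<exists>C. \<forall>N. (\<Sum>e\<in>{1..N}. ln (real e) / (real e)\<^sup>2) \<le> C"
proof -
  have "summable (\<lambda>e. 2 * real e powr (-3/2))"
    by (intro summable_mult) (simp add: summable_real_powr_iff)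
  moreover have "ln (real e) / (real e)\<^sup>2 \<le> 2 * real e powr (-3/2)" for e :: nat
  proof (cases "e = 0")
    case False
    have "ln (real e) \<le> 2 * real e powr (1/2)"
      using ln_powr_bound[of "real e" "1/2"] False by simp
    hence "ln (real e) / (real e)\<^sup>2 \<le> 2 * real e powr (1/2) / (real e powr 2)"
      using False by (simp add: divide_right_mono)
    also have "\<dots> = 2 * (real e powr (1/2) / real e powr 2)" by simp
    also have "real e powr (1/2) / real e powr 2 = real e powr (-3/2)"
      using powr_diff[of "real e" "1/2" 2] by simp
    finally show ?thesis .
  qed auto
  ultimately have "(\<Sum>e\<in>{1..N}. ln (real e) / (real e)\<^sup>2) \<le> (\<Sum>e. 2 * real e powr (-3/2))" for N
    by (intro order.trans[OF sum_mono sum_le_suminf]) auto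
  thus ?thesis by blast
qed

text \<open>Weighting prime powers by \<open>\<Prod>i. \<epsilon> i * \<psi> i d + 1\<close> and expanding, every nonempty product of the characters
  contributes a bounded sum, while the principal character contributes an unbounded one. Odd powers of a
  prime carry the same character values as the prime, and even powers contribute only a bounded sum.\<close>

lemma exists_prime_with_character_values:
  fixes \<psi> :: "'i \<Rightarrow> nat \<Rightarrow> real" and \<epsilon> :: "'i \<Rightarrow> real"
  assumes I: "finite I" and M: "M > 0"
    and one: "\<And>i. i \<in> I \<Longrightarrow> \<psi> i (Suc 0) = 1"
    and mult: "\<And>i a b. i \<in> I \<Longrightarrow> \<psi> i (a * b) = \<psi> i a * \<psi> i b"
    and per: "\<And>i n. i \<in> I \<Longrightarrow> \<psi> i (n + M) = \<psi> i n"
    and vals: "\<And>i n. i \<in> I \<Longrightarrow> coprime n M \<Longrightarrow> \<psi> i n \<in> {-1, 1}"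
    and indep: "\<And>i. i \<in> I \<Longrightarrow> \<exists>u. coprime u M \<and> \<psi> i u = -1 \<and> (\<forall>j\<in>I-{i}. \<psi> j u = 1)"
    and \<epsilon>: "\<And>i. i \<in> I \<Longrightarrow> \<epsilon> i \<in> {-1, 1}"
  shows "\<exists>q. prime q \<and> coprime q M \<and> (\<forall>i\<in>I. \<psi> i q = \<epsilon> i)"
proof (rule ccontr)
  assume none: "\<not> ?thesis"
  define c :: "nat \<Rightarrow> real" where "c n = of_bool (coprime n M)" for n
  define f where "f S n = c n * (\<Prod>i\<in>S. \<psi> i n)" for S n
  have char: "nonprincipal_real_character (f S) M" if S: "S \<subseteq> I" "S \<noteq> {}" for S
  proof
    have fin: "finite S" using S I finite_subset by blast
    show mult': "f S (a * b) = f S a * f S b" for a b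
      using S mult by (auto simp: f_def c_def prod.distrib subset_iff intro!: prod.cong)
    show per': "f S (n + M) = f S n" for n
    proof -
      have "coprime (n + M) M \<longleftrightarrow> coprime n M" by (metis coprime_iff_gcd_eq_1 gcd_add1)
      moreover have "(\<Prod>i\<in>S. \<psi> i (n + M)) = (\<Prod>i\<in>S. \<psi> i n)"
        using S per by (intro prod.cong) auto
      ultimately show ?thesis by (simp add: f_def c_def)
    qed
    have absv: "\<bar>\<Prod>i\<in>S. \<psi> i n\<bar> = 1" if "coprime n M" for n
    proof -
      have "\<bar>\<psi> i n\<bar> = 1" if "i \<in> S" for i using vals[OF subsetD[OF S(1) that] \<open>coprime n M\<close>] by auto
      thus ?thesis unfolding abs_prod by simp
    qed
    show "f S n \<in> {-1, 0, 1}" for n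
      using absv[of n] by (cases "coprime n M") (auto simp: f_def c_def abs_if split: if_splits)
    obtain i where i: "i \<in> S" using S by blast
    obtain u where u: "coprime u M" "\<psi> i u = -1" "\<forall>j\<in>I-{i}. \<psi> j u = 1"
      using indep[OF subsetD[OF S(1) i]] by blast
    have "(\<Prod>j\<in>S. \<psi> j u) = \<psi> i u * (\<Prod>j\<in>S-{i}. \<psi> j u)"
      using i fin by (simp add: prod.remove)
    also have "(\<Prod>j\<in>S-{i}. \<psi> j u) = 1" using u S by (intro prod.neutral) auto
    finally have fu: "f S u = -1" using u by (simp add: f_def c_def)
    have fmod: "f S (n mod M) = f S n" for n
    proof -
      have "f S (r + k * M) = f S r" for r k
        by (induction k) (use per' in \<open>auto simp: add.assoc[symmetric] add.commute[of M]\<close>)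
      from this[of "n mod M" "n div M"] show ?thesis by simp
    qed
    \<comment> \<open>Multiplication by \<open>u\<close> permutes the residues and reverses the sign
      of \<open>f S\<close>, so the sum over a period equals its own negative.\<close>
    have bij: "bij_betw (\<lambda>n. u * n mod M) {..<M} {..<M}"
    proof -
      have inj: "inj_on (\<lambda>n. u * n mod M) {..<M}"
      proof (rule inj_onI)
        fix x y assume xy: "x \<in> {..<M}" "y \<in> {..<M}" "u * x mod M = u * y mod M"
        hence "[u * x = u * y] (mod M)" by (simp add: cong_def)
        hence "[x = y] (mod M)" using u(1) by (simp add: cong_mult_lcancel_nat)
        thus "x = y" using xy by (simp add: cong_def)
      qed
      have "(\<lambda>n. u * n mod M) ` {..<M} \<subseteq> {..<M}" using M by auto
      thus ?thesis using inj by (simp add: bij_betw_def endo_inj_surj)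
    qed
    have "(\<Sum>n<M. f S n) = (\<Sum>n<M. f S (u * n mod M))"
      using sum.reindex_bij_betw[OF bij, of "f S"] by simp
    also have "\<dots> = - (\<Sum>n<M. f S n)" by (simp add: fmod mult' fu sum_negf)
    finally show "(\<Sum>n<M. f S n) = 0" by simp
    show "f S (Suc 0) = 1" using S one by (auto simp: f_def c_def subset_iff intro!: prod.neutral)
  qed (rule M)
  have "\<forall>S\<in>Pow I - {{}}. \<exists>C. \<forall>N. \<bar>\<Sum>d\<in>{1..N}. f S d * (mangoldt d / real d)\<bar> \<le> C"
    using nonprincipal_real_character.sum_mangoldt_bounded[OF char] by auto
  then obtain C where C: "\<And>S N. S \<in> Pow I - {{}} \<Longrightarrow> \<bar>\<Sum>d\<in>{1..N}. f S d * (mangoldt d / real d)\<bar> \<le> C S"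
    by metis
  define G where "G N = (\<Sum>d\<in>{1..N}. c d * (mangoldt d / real d) * (\<Prod>i\<in>I. \<epsilon> i * \<psi> i d + 1))" for N
  have expand: "G N = (\<Sum>S\<in>Pow I. (\<Prod>i\<in>S. \<epsilon> i) * (\<Sum>d\<in>{1..N}. f S d * (mangoldt d / real d)))" for N
  proof -
    have "G N = (\<Sum>d\<in>{1..N}. \<Sum>S\<in>Pow I. (\<Prod>i\<in>S. \<epsilon> i) * (f S d * (mangoldt d / real d)))"
      unfolding G_def prod_add[OF I] f_def
      by (simp add: sum_distrib_left prod.distrib mult_ac)
    also have "\<dots> = (\<Sum>S\<in>Pow I. \<Sum>d\<in>{1..N}. (\<Prod>i\<in>S. \<epsilon> i) * (f S d * (mangoldt d / real d)))"
      by (rule sum.swap)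
    finally show ?thesis by (simp add: sum_distrib_left)
  qed
  have abs_eps: "\<bar>\<Prod>i\<in>S. \<epsilon> i\<bar> = 1" if "S \<subseteq> I" for S
  proof -
    have "\<bar>\<epsilon> i\<bar> = 1" if "i \<in> S" for i using \<epsilon>[OF subsetD[OF \<open>S \<subseteq> I\<close> that]] by auto
    thus ?thesis unfolding abs_prod by simp
  qed
  have lower: "(\<Sum>d\<in>{1..N}. c d * (mangoldt d / real d)) \<le> G N + (\<Sum>S\<in>Pow I-{{}}. C S)" for N
  proof -
    have "G N = (\<Sum>d\<in>{1..N}. c d * (mangoldt d / real d))
       + (\<Sum>S\<in>Pow I-{{}}. (\<Prod>i\<in>S. \<epsilon> i) * (\<Sum>d\<in>{1..N}. f S d * (mangoldt d / real d)))"
      unfolding expand using I by (subst sum.remove[of _ "{}"]) (auto simp: f_def)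
    moreover have "\<bar>\<Sum>S\<in>Pow I-{{}}. (\<Prod>i\<in>S. \<epsilon> i) * (\<Sum>d\<in>{1..N}. f S d * (mangoldt d / real d))\<bar>
        \<le> (\<Sum>S\<in>Pow I-{{}}. C S)"
      using C abs_eps by (intro order.trans[OF sum_abs] sum_mono) (auto simp: abs_mult)
    ultimately show ?thesis by linarith
  qed
  obtain D where D: "\<And>N. (\<Sum>e\<in>{1..N}. ln (real e) / (real e)\<^sup>2) \<le> D"
    using sum_ln_over_square_bounded by blast
  have upper: "G N \<le> 2 * 2 ^ card I * D" for N
  proof -
    define g where "g d = c d * (mangoldt d / real d) * (\<Prod>i\<in>I. \<epsilon> i * \<psi> i d + 1)" for d
    \<comment> \<open>If \<open>d = p ^ k\<close> with \<open>k\<close> odd has nonzero weight, no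
      factor \<open>\<epsilon> i * \<psi> i d + 1\<close> vanishes, so
      \<open>\<psi> i p = \<psi> i d = \<epsilon> i\<close> and \<open>p\<close> is the prime
      assumed not to exist. Hence only squares contribute.\<close>
    have g0: "g d = 0" if d: "d \<in> {1..N} - (\<lambda>e. e\<^sup>2) ` {1..N}" for d
    proof (rule ccontr)
      assume "g d \<noteq> 0"
      hence nz: "coprime d M" "mangoldt d \<noteq> (0::real)" "(\<Prod>i\<in>I. \<epsilon> i * \<psi> i d + 1) \<noteq> 0"
        by (auto simp: g_def c_def)
      have "primepow d" using nz(2) unfolding mangoldt_def by (rule contrapos_np) simp
      then obtain p k where pk: "prime p" "k > 0" "d = p ^ k" by (auto simp: primepow_def)
      have copp: "coprime p M" using nz(1) pk by simp
      show False
      proof (cases "even k")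
        case True
        then obtain l where l: "k = 2 * l" by auto
        have "p ^ l \<le> d" unfolding pk l using pk by (intro power_increasing) (auto simp: prime_gt_0_nat Suc_leI)
        moreover have "d = (p ^ l)\<^sup>2" using pk l by (simp add: power_mult mult.commute flip: power_mult)
        moreover have "p ^ l \<ge> 1" using pk by (simp add: prime_gt_0_nat Suc_leI)
        ultimately show False using d by auto
      next
        case False
        have "\<psi> i p = \<epsilon> i" if i: "i \<in> I" for i
        proof -
          have pw: "\<psi> i (p ^ j) = \<psi> i p ^ j" for j by (induction j) (auto simp: one mult i)
          have "\<psi> i d = \<psi> i p"
            using vals[OF i copp] False unfolding pk(3) pw by auto
          moreover have "\<epsilon> i * \<psi> i d + 1 \<noteq> 0" using nz(3) I i by auto
          ultimately show ?thesis using vals[OF i copp] \<epsilon>[OF i] by auto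
        qed
        thus False using none pk copp by blast
      qed
    qed
    have "G N = (\<Sum>d\<in>{1..N}. g d)" by (simp add: G_def g_def)
    also have "\<dots> = (\<Sum>d\<in>{1..N} \<inter> (\<lambda>e. e\<^sup>2) ` {1..N}. g d)"
      using g0 by (intro sum.mono_neutral_right) auto
    also have "\<dots> \<le> (\<Sum>d\<in>{1..N} \<inter> (\<lambda>e. e\<^sup>2) ` {1..N}. 2 ^ card I * (ln (real d) / real d))"
    proof (rule sum_mono)
      fix d assume d: "d \<in> {1..N} \<inter> (\<lambda>e. e\<^sup>2) ` {1..N}"
      show "g d \<le> 2 ^ card I * (ln (real d) / real d)"
      proof (cases "coprime d M")
        case True
        have "(\<Prod>i\<in>I. \<epsilon> i * \<psi> i d + 1) \<le> (\<Prod>i\<in>I. 2)"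
          using vals[OF _ True] \<epsilon> by (intro prod_mono) fastforce
        hence 1: "(\<Prod>i\<in>I. \<epsilon> i * \<psi> i d + 1) \<le> 2 ^ card I" by simp
        have "g d = mangoldt d / real d * (\<Prod>i\<in>I. \<epsilon> i * \<psi> i d + 1)"
          using True by (simp add: g_def c_def)
        also have "\<dots> \<le> mangoldt d / real d * 2 ^ card I"
          using 1 by (intro mult_left_mono) (auto simp: mangoldt_nonneg)
        also have "\<dots> \<le> ln (real d) / real d * 2 ^ card I"
          using d mangoldt_le[of d] by (intro mult_right_mono divide_right_mono) auto
        finally show ?thesis by (simp add: mult.commute)
      next
        case False
        thus ?thesis using d by (auto simp: g_def c_def)
      qed
    qed
    also have "\<dots> \<le> (\<Sum>d\<in>(\<lambda>e. e\<^sup>2) ` {1..N}. 2 ^ card I * (ln (real d) / real d))"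
      by (intro sum_mono2) (auto intro!: divide_nonneg_nonneg ln_ge_zero simp: Suc_le_eq)
    also have "\<dots> = (\<Sum>e\<in>{1..N}. 2 ^ card I * (ln (real (e\<^sup>2)) / real (e\<^sup>2)))"
      by (subst sum.reindex) (auto simp: inj_on_def power2_eq_iff_nonneg)
    also have "\<dots> = 2 * 2 ^ card I * (\<Sum>e\<in>{1..N}. ln (real e) / (real e)\<^sup>2)"
      unfolding sum_distrib_left by (intro sum.cong) (auto simp: ln_realpow)
    also have "\<dots> \<le> 2 * 2 ^ card I * D" using D by (intro mult_left_mono) auto
    finally show ?thesis .
  qed
  obtain N where "(\<Sum>d\<in>{1..N}. of_bool (coprime d M) * (mangoldt d / real d))
     > 2 * 2 ^ card I * D + (\<Sum>S\<in>Pow I-{{}}. C S)"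
    using sum_coprime_mangoldt_unbounded[OF M] by blast
  thus False using lower[of N] upper[of N] unfolding c_def by linarith
qed

section \<open>Rational and integral solutions of ternary equations\<close>

lemma exists_nearest_multiple:
  fixes x t :: int
  assumes "t > 0"
  shows "\<exists>u. 2 * \<bar>x - t * u\<bar> \<le> t"
proof -
  define u where "u = (2 * x + t) div (2 * t)"
  define r where "r = (2 * x + t) mod (2 * t)"
  have "0 \<le> r" "r < 2 * t" using assms by (auto simp: r_def)
  moreover have "2 * x + t = 2 * t * u + r" by (simp add: u_def r_def)
  ultimately have "2 * \<bar>x - t * u\<bar> \<le> t" by (simp add: abs_le_iff algebra_simps abs_if)
  thus ?thesis by blast
qed

section \<open>Descent from rational to integral points\<close>

definition tform :: "int \<Rightarrow> int \<Rightarrow> int \<Rightarrow> int \<Rightarrow> int" where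
  "tform a x z w = a * x\<^sup>2 + (z\<^sup>2 + z * w + w\<^sup>2)"

text \<open>The polar form \<open>Q (v + v') - Q v - Q v'\<close> of \<open>tform\<close>, not
  halved, so that it stays integral.\<close>

definition tpolar :: "int \<Rightarrow> int \<Rightarrow> int \<Rightarrow> int \<Rightarrow> int \<Rightarrow> int \<Rightarrow> int \<Rightarrow> int" where
  "tpolar a x z w x' z' w' = 2 * a * x * x' + 2 * z * z' + z * w' + w * z' + 2 * w * w'"

lemma tform_combination:
  "tform a (s * x + t * x') (s * z + t * z') (s * w + t * w')
   = s\<^sup>2 * tform a x z w + s * t * tpolar a x z w x' z' w' + t\<^sup>2 * tform a x' z' w'"
  by (simp add: tform_def tpolar_def power2_eq_square algebra_simps)

lemma four_tform: "4 * tform a x z w = 4 * a * x\<^sup>2 + (2 * z + w)\<^sup>2 + 3 * w\<^sup>2"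
  by (simp add: tform_def power2_eq_square algebra_simps)

text \<open>The line through the rational point and a nearest integral point meets the quadric in a second
  rational point, whose denominator is smaller because both forms are Euclidean.\<close>

lemma davenport_cassels:
  assumes a: "a = 1 \<or> a = 2" and "t > 0" "tform a x z w = m * t\<^sup>2"
  shows "\<exists>x z w. tform a x z w = m"
  using assms(2,3)
proof (induction "nat t" arbitrary: t x z w rule: less_induct)
  case less
  obtain u1 where u1: "2 * \<bar>x - t * u1\<bar> \<le> t" using exists_nearest_multiple[OF less.prems(1)] by blast
  obtain u3 where u3: "2 * \<bar>w - t * u3\<bar> \<le> t" using exists_nearest_multiple[OF less.prems(1)] by blast
  \<comment> \<open>Rounding follows the completed square in \<open>four_tform\<close>: what is made
    small is \<open>2 * r2 + r3\<close> rather than \<open>r2\<close>, so \<open>u2\<close> depends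
    on \<open>u3\<close>.\<close>
  obtain u2 where u2: "2 * \<bar>2 * z + (w - t * u3) - 2 * t * u2\<bar> \<le> 2 * t"
    using exists_nearest_multiple[of "2 * t"] less.prems(1) by (metis mult_pos_pos zero_less_numeral)
  define r1 r2 r3 where "r1 = x - t * u1" and "r2 = z - t * u2" and "r3 = w - t * u3"
  define U R where "U = tform a u1 u2 u3" and "R = tform a r1 r2 r3"
  define P where "P = tpolar a u1 u2 u3 r1 r2 r3"
  have "tform a x z w = tform a (t * u1 + 1 * r1) (t * u2 + 1 * r2) (t * u3 + 1 * r3)"
    by (simp add: r1_def r2_def r3_def)
  hence mt: "m * t\<^sup>2 = t\<^sup>2 * U + t * P + R"
    unfolding tform_combination U_def P_def R_def using less.prems(2) by simp
  \<comment> \<open>\<open>R\<close> is divisible by \<open>t\<close>; the quotient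
    \<open>t'\<close> becomes the denominator of the second intersection point.\<close>
  define t' where "t' = m * t - t * U - P"
  have R: "R = t * t'" using mt by (simp add: t'_def power2_eq_square algebra_simps)
  have b1: "4 * r1\<^sup>2 \<le> t\<^sup>2" using power_mono[of "2 * \<bar>r1\<bar>" t 2] u1 by (simp add: r1_def power_mult_distrib)
  have b3: "4 * r3\<^sup>2 \<le> t\<^sup>2" using power_mono[of "2 * \<bar>r3\<bar>" t 2] u3 by (simp add: r3_def power_mult_distrib)
  have b2: "(2 * r2 + r3)\<^sup>2 \<le> t\<^sup>2"
  proof -
    have "2 * r2 + r3 = 2 * z + (w - t * u3) - 2 * t * u2" by (simp add: r2_def r3_def algebra_simps)
    hence "\<bar>2 * r2 + r3\<bar> \<le> t" using u2 by simp
    from power_mono[OF this, of 2] show ?thesis by simp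
  qed
  \<comment> \<open>The three squares give \<open>4 * R \<le> 2 * t^2 + t^2 + (3/4) * t^2\<close>;
    with \<open>a = 3\<close> the bound would exceed \<open>4 * t^2\<close>.\<close>
  have "16 * R \<le> 15 * t\<^sup>2"
  proof -
    have "4 * a * r1\<^sup>2 \<le> 2 * t\<^sup>2" using a b1 by (elim disjE) (simp_all, use zero_le_power2[of t] in linarith)
    thus ?thesis using four_tform[of a r1 r2 r3] b2 b3 unfolding R_def[symmetric] by linarith
  qed
  moreover have "t\<^sup>2 > 0" using less.prems(1) by simp
  ultimately have "R < t\<^sup>2" by linarith
  hence t't: "t' < t" unfolding R power2_eq_square using less.prems(1) by simp
  have "4 * a * r1\<^sup>2 \<ge> 0" using a by auto
  hence "R \<ge> 0" using four_tform[of a r1 r2 r3] zero_le_power2[of "2 * r2 + r3"] zero_le_power2[of r3]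
    unfolding R_def[symmetric] by linarith
  hence "t' \<ge> 0" unfolding R using less.prems(1) by (simp add: zero_le_mult_iff)
  show ?case
  proof (cases "t' = 0")
    case True
    hence "R = 0" using R by simp
    hence "4 * a * r1\<^sup>2 + (2 * r2 + r3)\<^sup>2 + 3 * r3\<^sup>2 = 0" using four_tform[of a r1 r2 r3] R_def by simp
    moreover have "4 * a * r1\<^sup>2 \<ge> 0" using a by auto
    moreover have "(2 * r2 + r3)\<^sup>2 \<ge> 0" "3 * r3\<^sup>2 \<ge> 0" by auto
    ultimately have "4 * a * r1\<^sup>2 = 0" "(2 * r2 + r3)\<^sup>2 = 0" "3 * r3\<^sup>2 = 0" by linarith+
    hence "r1 = 0" "r2 = 0" "r3 = 0" using a by auto
    hence "P = 0" by (simp add: P_def tpolar_def)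
    hence "m * t\<^sup>2 = U * t\<^sup>2" using mt \<open>R = 0\<close> by simp
    hence "U = m" using less.prems(1) by simp
    thus ?thesis unfolding U_def by blast
  next
    case False
    hence t'0: "t' > 0" using \<open>t' \<ge> 0\<close> by simp
    \<comment> \<open>On the line \<open>u + s * r\<close> the given point has
      \<open>s = 1 / t\<close>, and the other root is \<open>s = k / t'\<close>.\<close>
    define k where "k = U - m"
    have "P = - (k * t) - t'" by (simp add: t'_def k_def algebra_simps)
    hence "tform a (t' * u1 + k * r1) (t' * u2 + k * r2) (t' * u3 + k * r3)
        = t'\<^sup>2 * U + t' * k * (- (k * t) - t') + k\<^sup>2 * (t * t')"
      unfolding tform_combination U_def[symmetric] P_def[symmetric] R_def[symmetric] R by simp
    also have "\<dots> = m * t'\<^sup>2" by (simp add: k_def power2_eq_square algebra_simps)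
    finally show ?thesis using less.hyps[of t'] t't t'0 by auto
  qed
qed

text \<open>\<open>z^2 + z w + w^2\<close> at \<open>(Z - W, 2 W)\<close> is
  \<open>Z^2 + 3 W^2\<close>, so the two equations combine to a rational point with denominator
  \<open>k * z\<close>.\<close>

lemma represented_of_rational:
  fixes a c k Z W m x y z :: int
  assumes a: "a = 1 \<or> a = 2" and k: "k \<noteq> 0" "Z\<^sup>2 + 3 * W\<^sup>2 = c * k\<^sup>2"
    and z: "z \<noteq> 0" "a * x\<^sup>2 + c * y\<^sup>2 = m * z\<^sup>2"
  shows "\<exists>x z w. tform a x z w = m"
proof (rule davenport_cassels[OF a])
  show "\<bar>k * z\<bar> > 0" using k z by simp
  have "tform a (k * x) (y * Z - y * W) (2 * (y * W)) = a * x\<^sup>2 * k\<^sup>2 + y\<^sup>2 * (Z\<^sup>2 + 3 * W\<^sup>2)"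
    by (simp add: tform_def power2_eq_square algebra_simps)
  also have "\<dots> = (a * x\<^sup>2 + c * y\<^sup>2) * k\<^sup>2" unfolding k(2) by (simp add: algebra_simps)
  also have "\<dots> = m * \<bar>k * z\<bar>\<^sup>2" unfolding z(2) by (simp add: power_mult_distrib)
  finally show "tform a (k * x) (y * Z - y * W) (2 * (y * W)) = m * \<bar>k * z\<bar>\<^sup>2" .
qed

section \<open>Legendre's theorem on ternary equations\<close>

lemma int_sqrt_bounds:
  fixes n :: int
  assumes "n \<ge> 0"
  shows "\<exists>X\<ge>0. X\<^sup>2 \<le> n \<and> n < (X + 1)\<^sup>2"
proof -
  define X where "X = \<lfloor>sqrt (of_int n)\<rfloor>"
  have s: "0 \<le> sqrt (of_int n :: real)" "(sqrt (of_int n))\<^sup>2 = (of_int n :: real)" using assms by auto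
  have X0: "X \<ge> 0" unfolding X_def using s by simp
  have "of_int X \<le> sqrt (of_int n :: real)" "sqrt (of_int n) < of_int X + (1::real)"
    unfolding X_def by linarith+
  hence "(of_int X)\<^sup>2 \<le> (sqrt (of_int n :: real))\<^sup>2" "(sqrt (of_int n))\<^sup>2 < (of_int X + (1::real))\<^sup>2"
    using X0 s(1) by (simp_all only: power_mono power_strict_mono of_int_0_le_iff zero_less_numeral)
  hence "real_of_int (X\<^sup>2) \<le> of_int n" "real_of_int n < of_int ((X + 1)\<^sup>2)" using s(2) by simp_all
  hence "X\<^sup>2 \<le> n" "n < (X + 1)\<^sup>2" by linarith+
  thus ?thesis using X0 by blast
qed

text \<open>The congruences make \<open>A x\<^sup>2 + B y\<^sup>2 - C z\<^sup>2\<close> divisible by \<open>A B C\<close> on a lattice of index \<open>A B C\<close>, and the pigeonhole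
  principle on the box with sides \<open>\<surd>(B C)\<close>, \<open>\<surd>(C A)\<close>, \<open>\<surd>(A B)\<close> leaves only the values 0 and \<open>A B C\<close>.\<close>

lemma legendre_ternary:
  fixes A B C :: int
  assumes pos: "A > 0" "B > 0" "C > 0"
    and cop: "coprime A B" "coprime B C" "coprime A C"
    and r: "A dvd B * r\<^sup>2 - C" and s: "B dvd C * s\<^sup>2 - A" and k: "C dvd A * k\<^sup>2 + B"
    and nsq: "\<And>e. A * B \<noteq> e\<^sup>2" "\<And>e. B * C \<noteq> e\<^sup>2"
  shows "\<exists>x y z. z \<noteq> 0 \<and> A * x\<^sup>2 + B * y\<^sup>2 = C * z\<^sup>2"
proof -
  obtain X where X: "X \<ge> 0" "X\<^sup>2 \<le> B * C" "B * C < (X + 1)\<^sup>2" using int_sqrt_bounds[of "B * C"] pos by auto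
  obtain Y where Y: "Y \<ge> 0" "Y\<^sup>2 \<le> C * A" "C * A < (Y + 1)\<^sup>2" using int_sqrt_bounds[of "C * A"] pos by auto
  obtain Z where Z: "Z \<ge> 0" "Z\<^sup>2 \<le> A * B" "A * B < (Z + 1)\<^sup>2" using int_sqrt_bounds[of "A * B"] pos by auto
  define T where "T = {0..X} \<times> {0..Y} \<times> {0..Z}"
  \<comment> \<open>Equal residues put the difference of two box points on the lattice where
    \<open>y = r z\<close> modulo \<open>A\<close>, \<open>z = s x\<close> modulo \<open>B\<close>
    and \<open>x = k y\<close> modulo \<open>C\<close>.\<close>
  define \<phi> where "\<phi> = (\<lambda>(x, y, z). ((y - r * z) mod A, (z - s * x) mod B, (x - k * y) mod C))"
  have "(A * B * C)\<^sup>2 = (B * C) * (C * A) * (A * B)" by (simp add: power2_eq_square)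
  also have "\<dots> < (X + 1)\<^sup>2 * (Y + 1)\<^sup>2 * (Z + 1)\<^sup>2"
  proof -
    have "(B * C) * (C * A) < (X + 1)\<^sup>2 * (Y + 1)\<^sup>2"
      by (rule mult_strict_mono) (use X Y pos in simp_all)
    thus ?thesis by (rule mult_strict_mono) (use X Y Z pos in simp_all)
  qed
  also have "\<dots> = ((X + 1) * (Y + 1) * (Z + 1))\<^sup>2" by (simp add: power_mult_distrib)
  finally have lt: "A * B * C < (X + 1) * (Y + 1) * (Z + 1)"
    by (rule power2_less_imp_less) (use X(1) Y(1) Z(1) in simp)
  have cardT: "int (card T) = (X + 1) * (Y + 1) * (Z + 1)"
    using X(1) Y(1) Z(1) by (simp add: T_def card_cartesian_product)
  have sub: "\<phi> ` T \<subseteq> {0..<A} \<times> {0..<B} \<times> {0..<C}"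
    using pos by (auto simp: \<phi>_def)
  have "card (\<phi> ` T) \<le> card ({0..<A} \<times> {0..<B} \<times> {0..<C})"
    by (rule card_mono[OF _ sub]) auto
  also have "int \<dots> = A * B * C" using pos by (simp add: card_cartesian_product)
  finally have "card (\<phi> ` T) < card T" using lt cardT by linarith
  hence "\<not> inj_on \<phi> T" using pigeonhole by blast
  then obtain p1 p2 where p: "p1 \<in> T" "p2 \<in> T" "\<phi> p1 = \<phi> p2" "p1 \<noteq> p2"
    unfolding inj_on_def by blast
  obtain x1 y1 z1 where p1: "p1 = (x1, y1, z1)" by (cases p1)
  obtain x2 y2 z2 where p2: "p2 = (x2, y2, z2)" by (cases p2)
  note T = p(1,2)[unfolded p1 p2] and eq = p(3)[unfolded p1 p2] and ne = p(4)[unfolded p1 p2]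
  define x y z where "x = x1 - x2" and "y = y1 - y2" and "z = z1 - z2"
  have cong: "A dvd y - r * z" "B dvd z - s * x" "C dvd x - k * y"
    using eq by (auto simp: \<phi>_def x_def y_def z_def mod_eq_dvd_iff algebra_simps)
  have "\<bar>x\<bar> \<le> X" "\<bar>y\<bar> \<le> Y" "\<bar>z\<bar> \<le> Z" using T by (auto simp: T_def x_def y_def z_def)
  hence "x\<^sup>2 \<le> X\<^sup>2" "y\<^sup>2 \<le> Y\<^sup>2" "z\<^sup>2 \<le> Z\<^sup>2" by (simp_all add: abs_le_square_iff[symmetric])
  hence le: "x\<^sup>2 \<le> B * C" "y\<^sup>2 \<le> C * A" "z\<^sup>2 \<le> A * B" using X Y Z by linarith+
  have nz: "x \<noteq> 0 \<or> y \<noteq> 0 \<or> z \<noteq> 0" using ne by (auto simp: x_def y_def z_def)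
  define v where "v = A * x\<^sup>2 + B * y\<^sup>2 - C * z\<^sup>2"
  have dA: "A dvd v"
  proof -
    have "v = A * x\<^sup>2 + B * (y - r * z) * (y + r * z) + (B * r\<^sup>2 - C) * z\<^sup>2"
      by (simp add: v_def power2_eq_square algebra_simps)
    also have "A dvd \<dots>" using cong(1) r by (intro dvd_add) auto
    finally show ?thesis .
  qed
  have dB: "B dvd v"
  proof -
    have "v = B * y\<^sup>2 - C * (z - s * x) * (z + s * x) - (C * s\<^sup>2 - A) * x\<^sup>2"
      by (simp add: v_def power2_eq_square algebra_simps)
    also have "B dvd \<dots>" using cong(2) s by (intro dvd_diff) auto
    finally show ?thesis .
  qed
  have dC: "C dvd v"
  proof -
    have "v = A * (x - k * y) * (x + k * y) + (A * k\<^sup>2 + B) * y\<^sup>2 - C * z\<^sup>2"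
      by (simp add: v_def power2_eq_square algebra_simps)
    also have "C dvd \<dots>" using cong(3) k by (intro dvd_diff dvd_add) auto
    finally show ?thesis .
  qed
  have "A * B dvd v" using divides_mult[OF dA dB cop(1)] .
  hence "A * B * C dvd v" using dC cop by (intro divides_mult) auto
  then obtain j where j: "v = A * B * C * j" by (auto elim: dvdE)
  have ABC: "A * B * C > 0" using pos by simp
  have bA: "A * x\<^sup>2 \<le> A * B * C" using mult_left_mono[OF le(1), of A] pos by (simp add: mult.assoc)
  have bB: "B * y\<^sup>2 \<le> A * B * C" using mult_left_mono[OF le(2), of B] pos by (simp add: mult_ac)
  \<comment> \<open>Nonsquareness makes this bound and the next one strict, which excludes the
    values \<open>- A * B * C\<close> and \<open>2 * A * B * C\<close>.\<close>
  have bC: "C * z\<^sup>2 < A * B * C"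
  proof -
    have "z\<^sup>2 < A * B" using le(3) nsq(1)[of z] by linarith
    thus ?thesis using mult_strict_left_mono[of "z\<^sup>2" "A * B" C] pos by (simp add: mult_ac)
  qed
  have bA': "A * x\<^sup>2 < A * B * C"
  proof -
    have "x\<^sup>2 < B * C" using le(1) nsq(2)[of x] by linarith
    thus ?thesis using mult_strict_left_mono[of "x\<^sup>2" "B * C" A] pos by (simp add: mult_ac)
  qed
  have nn: "0 \<le> A * x\<^sup>2" "0 \<le> B * y\<^sup>2" "0 \<le> C * z\<^sup>2" using pos by auto
  have "A * B * C * j < A * B * C * 2" using bA' bB nn unfolding j[symmetric] v_def by linarith
  hence j2: "j < 2" using ABC by (simp add: mult_less_cancel_left_pos)
  have "A * B * C * (-1) < A * B * C * j" using bC nn unfolding j[symmetric] v_def by linarith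
  hence j1: "-1 < j" using ABC by (simp only: mult_less_cancel_left_pos)
  consider "j = 0" | "j = 1" using j1 j2 by linarith
  thus ?thesis
  proof cases
    case 1
    hence e: "A * x\<^sup>2 + B * y\<^sup>2 = C * z\<^sup>2" using j by (simp add: v_def)
    moreover have "z \<noteq> 0"
    proof
      assume "z = 0"
      hence "A * x\<^sup>2 + B * y\<^sup>2 = 0" using e by simp
      hence "A * x\<^sup>2 = 0" "B * y\<^sup>2 = 0" using nn by linarith+
      thus False using nz \<open>z = 0\<close> pos by auto
    qed
    ultimately show ?thesis by blast
  next
    case 2
    hence e: "A * x\<^sup>2 + B * y\<^sup>2 = C * (z\<^sup>2 + A * B)" using j by (simp add: v_def algebra_simps)
    \<comment> \<open>Composing \<open>A x^2 + B y^2\<close> with \<open>z^2 + A B\<close> turns the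
      value \<open>A * B * C\<close> into an actual zero, whose last coordinate
      \<open>z^2 + A * B\<close> is positive.\<close>
    have "A * (x * z + B * y)\<^sup>2 + B * (y * z - A * x)\<^sup>2 = (A * x\<^sup>2 + B * y\<^sup>2) * (z\<^sup>2 + A * B)"
      by (simp add: power2_eq_square algebra_simps)
    also have "\<dots> = C * (z\<^sup>2 + A * B)\<^sup>2" unfolding e by (simp add: power2_eq_square)
    finally have "A * (x * z + B * y)\<^sup>2 + B * (y * z - A * x)\<^sup>2 = C * (z\<^sup>2 + A * B)\<^sup>2" .
    moreover have "z\<^sup>2 + A * B > 0" using pos by (simp add: add_nonneg_pos)
    hence "z\<^sup>2 + A * B \<noteq> 0" by simp
    ultimately show ?thesis by blast
  qed
qed

text \<open>Chinese remaindering over the prime factors; squarefreeness makes each prime coprime to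
  its cofactor.\<close>

lemma quadratic_congruence_squarefree:
  fixes A B :: int
  assumes "C > 0" "squarefree C" "\<And>p. prime p \<Longrightarrow> p dvd C \<Longrightarrow> \<exists>t. int p dvd A * t\<^sup>2 + B"
  shows "\<exists>t. int C dvd A * t\<^sup>2 + B"
  using assms
proof (induction C rule: less_induct)
  case (less C)
  show ?case
  proof (cases "C = 1")
    case False
    then obtain p where p: "prime p" "p dvd C" using prime_factor_nat by blast
    then obtain D where D: "C = p * D" by auto
    have "D > 0" "D < C" using D less.prems(1) p(1) prime_gt_1_nat[of p] by auto
    have "\<not> p dvd D"
    proof
      assume "p dvd D"
      hence "p\<^sup>2 dvd C" by (simp add: D power2_eq_square)
      hence "is_unit p" using less.prems(2) by (auto simp: squarefree_def)
      thus False using p by auto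
    qed
    hence cop: "coprime (int p) (int D)" using p by (simp add: prime_imp_coprime)
    have "squarefree D" using less.prems(2) D squarefree_mono[of D C] by simp
    then obtain t where t: "int D dvd A * t\<^sup>2 + B"
      using less.IH[OF \<open>D < C\<close> \<open>D > 0\<close>] less.prems(3) D by auto
    obtain s where s: "int p dvd A * s\<^sup>2 + B" using less.prems(3) p by blast
    obtain x where x: "[x = s] (mod int p)" "[x = t] (mod int D)"
      using binary_chinese_remainder_int[OF cop] by blast
    have tr: "n dvd A * x\<^sup>2 + B" if "[x = y] (mod n)" "n dvd A * y\<^sup>2 + B" for n y :: int
    proof -
      have "[A * x\<^sup>2 + B = A * y\<^sup>2 + B] (mod n)"
        by (intro cong_add cong_mult cong_pow that cong_refl)
      thus ?thesis using that(2) cong_dvd_iff by blast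
    qed
    have "int p * int D dvd A * x\<^sup>2 + B"
      by (rule divides_mult[OF tr[OF x(1) s] tr[OF x(2) t] cop])
    thus ?thesis using D by auto
  qed auto
qed

lemma prime_mult_not_square:
  fixes n e :: int
  assumes "prime q" "\<not> q dvd n"
  shows "q * n \<noteq> e\<^sup>2"
proof
  assume "q * n = e\<^sup>2"
  hence "q dvd e\<^sup>2" by (metis dvd_triv_left)
  hence "q dvd e" using assms(1) prime_dvd_power by blast
  then obtain f where "e = q * f" by auto
  hence "q * n = q * (q * f\<^sup>2)" using \<open>q * n = e\<^sup>2\<close> by (simp add: power2_eq_square mult_ac)
  hence "n = q * f\<^sup>2" using assms(1) by (metis mult_cancel_left not_prime_0)
  thus False using assms(2) by simp
qed

section \<open>Quadratic residue symbols\<close>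

lemma Legendre_cong:
  assumes "[a = b] (mod p)"
  shows "Legendre a p = Legendre b p"
proof -
  have "[a = 0] (mod p) \<longleftrightarrow> [b = 0] (mod p)" using assms by (metis cong_trans cong_sym)
  moreover have "QuadRes p a \<longleftrightarrow> QuadRes p b"
    unfolding QuadRes_def using assms by (metis cong_trans cong_sym)
  ultimately show ?thesis by (simp add: Legendre_def)
qed

lemma Legendre_values: "Legendre a p \<in> {-1, 0, 1}"
  by (simp add: Legendre_def)

lemma Legendre_eq_0_iff: "Legendre a p = 0 \<longleftrightarrow> p dvd a"
  by (simp add: Legendre_def cong_0_iff)

lemma Legendre_eqI:
  assumes "p > 2" "[Legendre a p = v] (mod p)" "v \<in> {-1, 0, 1}"
  shows "Legendre a p = v"
proof -
  have "p dvd Legendre a p - v" using assms(2) by (simp add: cong_iff_dvd_diff)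
  moreover have "\<bar>Legendre a p - v\<bar> < p" using assms(1,3) Legendre_values[of a p] by auto
  ultimately show ?thesis by (metis dvd_imp_le_int eq_iff_diff_eq_0 not_le abs_ge_zero order.strict_trans1 abs_of_pos)
qed

lemma Legendre_mult:
  assumes "prime p" "2 < p"
  shows "Legendre (a * b) (int p) = Legendre a p * Legendre b p"
proof (rule Legendre_eqI)
  have "[Legendre (a * b) p = (a * b) ^ ((p - 1) div 2)] (mod int p)" by (rule euler_criterion[OF assms])
  moreover have "[Legendre a p * Legendre b p = a ^ ((p - 1) div 2) * b ^ ((p - 1) div 2)] (mod int p)"
    by (intro cong_mult euler_criterion[OF assms])
  ultimately show "[Legendre (a * b) p = Legendre a p * Legendre b p] (mod int p)"
    unfolding power_mult_distrib by (metis cong_trans cong_sym)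
  show "Legendre a p * Legendre b p \<in> {-1, 0, 1}"
    using Legendre_values[of a p] Legendre_values[of b p] by auto
qed (use assms in auto)

lemma Legendre_1: "p > 1 \<Longrightarrow> Legendre 1 p = 1"
  unfolding Legendre_def QuadRes_def
  by (auto simp: cong_0_iff intro: exI[of _ 1] dest: zdvd_imp_le)

lemma Legendre_eq_1_obtain:
  assumes "Legendre a p = 1"
  obtains y where "p dvd y\<^sup>2 - a"
  using assms that by (auto simp: Legendre_def QuadRes_def cong_iff_dvd_diff split: if_splits)

text \<open>\<open>chi4\<close> and \<open>chi8\<close> give the Legendre symbols of -1 and 2 at odd
  primes. Together they separate the odd classes modulo 8.\<close>

definition chi4 :: "nat \<Rightarrow> int" where
  "chi4 n = (if n mod 4 = 1 then 1 else if n mod 4 = 3 then -1 else 0)"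

definition chi8 :: "nat \<Rightarrow> int" where
  "chi8 n = (if n mod 8 \<in> {1, 7} then 1 else if n mod 8 \<in> {3, 5} then -1 else 0)"

lemma chi4_mult: "chi4 (a * b) = chi4 a * chi4 b"
proof -
  have "a * b mod 4 = (a mod 4) * (b mod 4) mod 4" by (simp add: mod_mult_eq)
  moreover have "a mod 4 \<in> {0, 1, 2, 3}" "b mod 4 \<in> {0, 1, 2, 3}" by auto
  ultimately show ?thesis by (elim insertE emptyE; simp add: chi4_def)
qed

lemma chi8_mult: "chi8 (a * b) = chi8 a * chi8 b"
proof -
  have "a * b mod 8 = (a mod 8) * (b mod 8) mod 8" by (simp add: mod_mult_eq)
  moreover have "a mod 8 \<in> {0, 1, 2, 3, 4, 5, 6, 7}" "b mod 8 \<in> {0, 1, 2, 3, 4, 5, 6, 7}" by auto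
  ultimately show ?thesis by (elim insertE emptyE; simp add: chi8_def)
qed

lemma chi4_mod8: "chi4 (n mod 8) = chi4 n"
  by (simp add: chi4_def mod_mod_cancel)

lemma chi8_mod8: "chi8 (n mod 8) = chi8 n"
  by (simp add: chi8_def)

lemma Legendre_minus_1:
  assumes "prime p" "2 < p"
  shows "Legendre (-1) (int p) = chi4 p"
proof (rule Legendre_eqI)
  have "odd p" using assms prime_odd_nat by blast
  hence "p mod 4 = 1 \<or> p mod 4 = 3" by presburger
  hence "(-1) ^ ((p - 1) div 2) = chi4 p"
  proof
    assume "p mod 4 = 1"
    moreover from this have "even ((p - 1) div 2)" by presburger
    ultimately show ?thesis by (simp add: chi4_def)
  next
    assume "p mod 4 = 3"
    moreover from this have "odd ((p - 1) div 2)" by presburger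
    ultimately show ?thesis by (simp add: chi4_def)
  qed
  thus "[Legendre (-1) (int p) = chi4 p] (mod int p)"
    using euler_criterion[OF assms, of "-1"] by simp
qed (use assms in \<open>auto simp: chi4_def\<close>)

text \<open>Gauss' lemma for the multiplier 2: with \<open>h = (p - 1) div 2\<close>, among the
  doubles of \<open>1..h\<close> exactly those of \<open>x > h div 2\<close> exceed
  \<open>h\<close>, and the parity of \<open>h - h div 2\<close> depends only on
  \<open>p mod 8\<close>.\<close>

lemma Legendre_2:
  assumes "prime p" "2 < p"
  shows "Legendre 2 (int p) = chi8 p"
proof -
  have odd: "odd p" using assms prime_odd_nat by blast
  have gauss: "GAUSS p 2"
    using assms by unfold_locales (auto simp: cong_0_iff dest: zdvd_imp_le)
  define h where "h = (int p - 1) div 2"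
  have p: "int p = 2 * h + 1" using odd unfolding h_def by presburger
  have "h \<ge> 1" using p assms by linarith
  have E: "GAUSS.E p 2 = (\<lambda>x. 2 * x) ` {h div 2 <.. h}"
  proof -
    have C: "GAUSS.C p 2 = (\<lambda>x. 2 * x) ` {0<..h}"
      unfolding GAUSS.C_def[OF gauss] GAUSS.B_def[OF gauss] GAUSS.A_def[OF gauss] image_image h_def[symmetric]
      using p by (intro image_cong refl) (auto simp: mult.commute)
    have "(\<lambda>x. 2 * x) ` {0<..h} \<inter> {h<..} = (\<lambda>x. 2 * x) ` {h div 2 <.. h}"
      using \<open>h \<ge> 1\<close> by (auto simp: image_iff)
    thus ?thesis unfolding GAUSS.E_def[OF gauss] C h_def[symmetric] .
  qed
  have "card (GAUSS.E p 2) = nat (h - h div 2)"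
    unfolding E by (subst card_image) (auto simp: inj_on_def)
  hence L: "Legendre 2 (int p) = (if even (h - h div 2) then 1 else -1)"
    using GAUSS.gauss_lemma[OF gauss] \<open>h \<ge> 1\<close> by (simp add: even_nat_iff uminus_power_if)
  have p8: "(2 * h + 1) mod 8 = int (p mod 8)" by (simp add: zmod_int flip: p)
  have "p mod 8 \<in> {1, 3, 5, 7}" using odd by simp presburger
  thus ?thesis
  proof (elim insertE)
    assume "p mod 8 = 1"
    moreover from this have "even (h - h div 2)" using p8 by simp presburger
    ultimately show ?thesis unfolding L by (simp add: chi8_def)
  next
    assume "p mod 8 = 3"
    moreover from this have "odd (h - h div 2)" using p8 by simp presburger
    ultimately show ?thesis unfolding L by (simp add: chi8_def)
  next
    assume "p mod 8 = 5"
    moreover from this have "odd (h - h div 2)" using p8 by simp presburger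
    ultimately show ?thesis unfolding L by (simp add: chi8_def)
  next
    assume "p mod 8 = 7"
    moreover from this have "even (h - h div 2)" using p8 by simp presburger
    ultimately show ?thesis unfolding L by (simp add: chi8_def)
  qed simp
qed

text \<open>For fixed \<open>q\<close> the sign is written as a completely multiplicative function
  of \<open>p\<close>, so that the law extends from primes to their products.\<close>

lemma Legendre_reciprocity:
  assumes "prime p" "2 < p" "prime q" "2 < q" "p \<noteq> q"
  shows "Legendre (int p) (int q) = Legendre (int q) (int p) * (if q mod 4 = 1 then 1 else chi4 p)"
proof -
  have odd: "odd p" "odd q" using assms prime_odd_nat by blast+
  have "\<not> p dvd q" "\<not> q dvd p" using assms primes_dvd_imp_eq by blast+
  hence v: "Legendre (int q) (int p) \<in> {-1, 1}" "Legendre (int p) (int q) \<in> {-1, 1}"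
    using Legendre_values[of "int q" "int p"] Legendre_values[of "int p" "int q"]
          Legendre_eq_0_iff[of "int q" "int p"] Legendre_eq_0_iff[of "int p" "int q"] by auto
  have "(-1::int) ^ ((p - 1) div 2 * ((q - 1) div 2)) = (if q mod 4 = 1 then 1 else chi4 p)"
  proof (cases "q mod 4 = 1")
    case True
    hence "even ((q - 1) div 2)" by presburger
    thus ?thesis using True by simp
  next
    case False
    hence q3: "odd ((q - 1) div 2)" using odd by presburger
    have "p mod 4 = 1 \<or> p mod 4 = 3" using odd(1) by presburger
    then consider "p mod 4 = 1" | "p mod 4 = 3" by blast
    thus ?thesis
    proof cases
      case 1
      hence "even ((p - 1) div 2)" by presburger
      thus ?thesis using 1 by (simp add: chi4_def)
    next
      case 2
      hence "odd ((p - 1) div 2)" by presburger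
      thus ?thesis using 2 q3 False by (simp add: chi4_def)
    qed
  qed
  with Quadratic_Reciprocity[OF assms]
  have eq: "Legendre (int p) (int q) * Legendre (int q) (int p) = (if q mod 4 = 1 then 1 else chi4 p)" by simp
  have "Legendre (int q) (int p) * Legendre (int q) (int p) = 1" using v(1) by auto
  hence "Legendre (int p) (int q) = Legendre (int p) (int q) * (Legendre (int q) (int p) * Legendre (int q) (int p))"
    by simp
  also have "\<dots> = Legendre (int q) (int p) * (Legendre (int p) (int q) * Legendre (int q) (int p))"
    by (simp only: mult_ac)
  finally show ?thesis unfolding eq .
qed

text \<open>Takes the place of Jacobi symbols: symbols of \<open>m\<close> are computed prime by
  prime.\<close>

lemma multiplicative_eqI:
  fixes f g :: "nat \<Rightarrow> int"
  assumes "f 1 = 1" "g 1 = 1" "\<And>a b. f (a * b) = f a * f b" "\<And>a b. g (a * b) = g a * g b"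
    and "m > 0" "\<And>p. prime p \<Longrightarrow> p dvd m \<Longrightarrow> f p = g p"
  shows "f m = g m"
  using assms(5,6)
proof (induction m rule: less_induct)
  case (less m)
  show ?case
  proof (cases "m = 1")
    case True
    thus ?thesis using assms(1,2) by simp
  next
    case False
    then obtain p where p: "prime p" "p dvd m" using prime_factor_nat by blast
    then obtain D where D: "m = p * D" by auto
    have "D > 0" "D < m" using D less.prems(1) p(1) prime_gt_1_nat[of p] by auto
    hence "f D = g D" using less D by auto
    moreover have "f p = g p" using less.prems(2) p by blast
    ultimately show ?thesis by (simp add: D assms(3,4))
  qed
qed

text \<open>Counting: up to sign every root lies in \<open>1..h\<close>, so at most \<open>h\<close>
  of the \<open>2 * h\<close> nonzero residues are squares.\<close>

lemma exists_nonresidue: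
  assumes "prime p" "2 < p"
  shows "\<exists>u. Legendre (int u) (int p) = -1"
proof (rule ccontr)
  assume none: "\<not> ?thesis"
  have nz: "Legendre (int u) (int p) = 1" if "u \<in> {0<..<p}" for u
    using none that Legendre_values[of "int u" "int p"] Legendre_eq_0_iff[of "int u" "int p"]
    by (auto dest: dvd_imp_le)
  define h where "h = (p - 1) div 2"
  have p: "p = 2 * h + 1" unfolding h_def using assms prime_odd_nat[of p] by presburger
  have "{0<..<p} \<subseteq> (\<lambda>y. y\<^sup>2 mod p) ` {0<..h}"
  proof
    fix u assume u: "u \<in> {0<..<p}"
    obtain y where y: "int p dvd y\<^sup>2 - int u" using Legendre_eq_1_obtain nz[OF u] by metis
    define z where "z = y mod int p"
    have z0: "0 \<le> z" "z < int p" using p by (auto simp: z_def)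
    have "[z\<^sup>2 = y\<^sup>2] (mod int p)" unfolding z_def by (intro cong_pow) (simp add: cong_def)
    hence zu: "[z\<^sup>2 = int u] (mod int p)" using y cong_iff_dvd_diff cong_trans by blast
    have "z \<noteq> 0"
    proof
      assume "z = 0"
      hence "int p dvd int u" using zu by (simp add: cong_iff_dvd_diff)
      thus False using u by (auto dest: dvd_imp_le)
    qed
    define w where "w = (if nat z \<le> h then nat z else p - nat z)"
    have w: "w \<in> {0<..h}" using z0 \<open>z \<noteq> 0\<close> p unfolding w_def by (auto simp: nat_le_iff)
    have "[int w = z] (mod int p) \<or> [int w = - z] (mod int p)"
      using z0 unfolding w_def by (auto simp: cong_iff_dvd_diff of_nat_diff)
    hence "[(int w)\<^sup>2 = z\<^sup>2] (mod int p)"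
      using cong_pow[of "int w" _ "int p" 2] by fastforce
    hence "[(int w)\<^sup>2 = int u] (mod int p)" using zu cong_trans by blast
    hence "[w\<^sup>2 = u] (mod p)" by (metis cong_int_iff of_nat_power)
    hence "w\<^sup>2 mod p = u" using u by (simp add: cong_def)
    thus "u \<in> (\<lambda>y. y\<^sup>2 mod p) ` {0<..h}" using w by blast
  qed
  hence "card {0<..<p} \<le> card {0<..h}" using surj_card_le by blast
  thus False using p assms by simp
qed

lemma exists_prime_with_residues:
  fixes \<epsilon> :: "nat \<Rightarrow> int"
  assumes fin: "finite P" and P: "\<And>p. p \<in> P \<Longrightarrow> prime p \<and> 2 < p"
    and \<epsilon>: "\<And>p. p \<in> P \<Longrightarrow> \<epsilon> p \<in> {-1, 1}"
    and r: "r \<in> {1, 3, 5, 7}"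
  obtains q where "prime q" "q mod 8 = r" "q \<notin> P" "\<And>p. p \<in> P \<Longrightarrow> Legendre (int q) (int p) = \<epsilon> p"
proof -
  define M where "M = 8 * \<Prod>P"
  \<comment> \<open>The indices 0 and 2 stand for \<open>chi4\<close> and \<open>chi8\<close>; they
    cannot clash with \<open>P\<close>, which contains odd primes only.\<close>
  define \<psi> :: "nat \<Rightarrow> nat \<Rightarrow> int" where
    "\<psi> i n = (if i = 0 then chi4 n else if i = 2 then chi8 n else Legendre (int n) (int i))" for i n
  define e where "e i = (if i = 0 then chi4 r else if i = 2 then chi8 r else \<epsilon> i)" for i
  let ?I = "insert 0 (insert 2 P)"
  have PM: "p dvd M" if "p \<in> P" for p unfolding M_def using fin that by (intro dvd_mult) auto
  have M0: "M > 0" unfolding M_def using P by (auto intro!: prod_pos dest: prime_gt_0_nat)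
  have mod48: "k mod 4 = k mod 8 mod 4" for k :: nat by (simp add: mod_mod_cancel)
  have cop_odd: "n mod 8 \<in> {1, 3, 5, 7}" if "coprime n M" for n
  proof -
    have "coprime n (2 * 4)" using that unfolding M_def by simp
    hence "coprime n 2" by (simp only: coprime_mult_right_iff)
    hence "odd n" by simp
    thus ?thesis by simp presburger
  qed
  have "\<exists>q. prime q \<and> coprime q M \<and> (\<forall>i\<in>?I. real_of_int (\<psi> i q) = real_of_int (e i))"
  proof (rule exists_prime_with_character_values)
    show "finite ?I" using fin by simp
  next
    fix i assume i: "i \<in> ?I"
    show "real_of_int (\<psi> i (Suc 0)) = 1"
      using i P[of i] by (auto simp: \<psi>_def chi4_def chi8_def Legendre_1)
  next
    fix i a b assume i: "i \<in> ?I"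
    show "real_of_int (\<psi> i (a * b)) = real_of_int (\<psi> i a) * real_of_int (\<psi> i b)"
      using i P[of i] by (auto simp: \<psi>_def chi4_mult chi8_mult Legendre_mult)
  next
    fix i n assume i: "i \<in> ?I"
    have "chi4 (n + M) = chi4 n" "chi8 (n + M) = chi8 n"
    proof -
      have "(n + M) mod 8 = n mod 8" by (simp add: M_def)
      moreover from this have "(n + M) mod 4 = n mod 4" by (metis mod48)
      ultimately show "chi4 (n + M) = chi4 n" "chi8 (n + M) = chi8 n" by (simp_all add: chi4_def chi8_def)
    qed
    moreover have "Legendre (int (n + M)) (int i) = Legendre (int n) (int i)" if "i \<in> P"
      using PM[OF that] by (intro Legendre_cong) (auto simp: cong_iff_dvd_diff)
    ultimately show "real_of_int (\<psi> i (n + M)) = real_of_int (\<psi> i n)"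
      using i by (auto simp: \<psi>_def)
  next
    fix i n assume i: "i \<in> ?I" and n: "coprime n M"
    have "n mod 8 \<in> {1, 3, 5, 7}" using cop_odd[OF n] .
    moreover from this have "n mod 4 \<in> {1, 3}" unfolding mod48[of n] by (elim insertE emptyE) simp_all
    moreover have "Legendre (int n) (int i) \<in> {-1, 1}" if "i \<in> P"
    proof -
      have "\<not> i dvd n"
      proof
        assume "i dvd n"
        hence "is_unit i" using n PM[OF that] coprime_common_divisor by blast
        thus False using P[OF that] by auto
      qed
      thus ?thesis using Legendre_values[of "int n" "int i"] Legendre_eq_0_iff[of "int n" "int i"] by auto
    qed
    ultimately show "real_of_int (\<psi> i n) \<in> {-1, 1}"
      using i by (auto simp: \<psi>_def chi4_def chi8_def)
  next
    fix i assume i: "i \<in> ?I"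
    show "\<exists>u. coprime u M \<and> real_of_int (\<psi> i u) = -1 \<and> (\<forall>j\<in>?I-{i}. real_of_int (\<psi> j u) = 1)"
    proof -
      obtain v where v: "i \<in> P \<Longrightarrow> Legendre (int v) (int i) = -1"
        using exists_nonresidue P by metis
      define modulus where "modulus j = (if j = 2 then 8 else j)" for j :: nat
      \<comment> \<open>Independence by Chinese remaindering: 7 modulo 8 flips only
        \<open>chi4\<close>, 5 flips only \<open>chi8\<close>, and a nonresidue \<open>v\<close>
        flips only the symbol at \<open>i\<close>.\<close>
      define target where "target j = (if j = 2 then (if i = 0 then 7 else if i = 2 then 5 else 1)
          else if j = i then v else 1)" for j :: nat
      have "\<forall>j\<in>insert 2 P. \<forall>k\<in>insert 2 P. j \<noteq> k \<longrightarrow> coprime (modulus j) (modulus k)"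
      proof (intro ballI impI)
        fix j k assume jk: "j \<in> insert 2 P" "k \<in> insert 2 P" "j \<noteq> k"
        have pr: "prime j" "prime k" using jk P by auto
        hence c: "coprime j k" using jk(3) primes_coprime by blast
        have "modulus l = l ^ (if l = 2 then 3 else 1)" for l by (simp add: modulus_def)
        thus "coprime (modulus j) (modulus k)" using c by (metis coprime_power_left_iff coprime_power_right_iff)
      qed
      from chinese_remainder_nat[OF _ this] obtain u where
        u: "\<forall>j\<in>insert 2 P. [u = target j] (mod modulus j)" using fin by blast
      have u8: "u mod 8 = (if i = 0 then 7 else if i = 2 then 5 else 1)"
        using u by (auto simp: modulus_def target_def cong_def)
      hence u4: "u mod 4 = (if i = 0 then 3 else 1)" unfolding mod48[of u] by simp
      have uj: "Legendre (int u) (int j) = (if j = i then -1 else 1)" if "j \<in> P" for j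
      proof -
        have "j \<noteq> 2" using P[OF that] by auto
        have "[u = target j] (mod j)" using u that P[OF that] by (auto simp: modulus_def)
        hence "[int u = int (target j)] (mod int j)" by (simp add: cong_int_iff)
        hence "Legendre (int u) (int j) = Legendre (int (target j)) (int j)" by (rule Legendre_cong)
        thus ?thesis using v that P[OF that] \<open>j \<noteq> 2\<close> by (auto simp: target_def Legendre_1)
      qed
      have "coprime u M"
      proof -
        have "odd u" using u8 by (auto split: if_splits; presburger)
        hence "coprime u (2 ^ 3)" by (subst coprime_power_right_iff) auto
        hence "coprime u 8" by simp
        moreover have "coprime u j" if "j \<in> P" for j
        proof -
          have "\<not> j dvd u" using uj[OF that] Legendre_eq_0_iff[of "int u" "int j"] by (auto split: if_splits)
          thus ?thesis using P[OF that] prime_imp_coprime coprime_commute by blast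
        qed
        hence "coprime u (\<Prod>P)" by (intro prod_coprime_right) auto
        ultimately show ?thesis unfolding M_def by simp
      qed
      moreover have "real_of_int (\<psi> i u) = -1"
        using i uj[of i] P[of 0] P[of 2] by (auto simp: \<psi>_def chi4_def chi8_def u8 u4)
      moreover have "real_of_int (\<psi> j u) = 1" if "j \<in> ?I - {i}" for j
        using that uj[of j] P[of 0] P[of 2] by (auto simp: \<psi>_def chi4_def chi8_def u8 u4)
      ultimately show ?thesis by blast
    qed
  next
    fix i assume i: "i \<in> ?I"
    have "r mod 4 \<in> {1, 3}" "r mod 8 \<in> {1, 3, 5, 7}" using r by auto
    thus "real_of_int (e i) \<in> {-1, 1}" using i \<epsilon>[of i] by (auto simp: e_def chi4_def chi8_def)
  qed (rule M0)
  then obtain q where q: "prime q" "coprime q M" "\<And>i. i \<in> ?I \<Longrightarrow> \<psi> i q = e i" by auto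
  have "q \<notin> P" using coprime_common_divisor[OF q(2) dvd_refl PM] q(1) by auto
  moreover have "Legendre (int q) (int p) = \<epsilon> p" if "p \<in> P" for p
    using q(3)[of p] that P[OF that] by (auto simp: \<psi>_def e_def)
  moreover have "q mod 8 = r"
  proof -
    have "chi4 (q mod 8) = chi4 r" "chi8 (q mod 8) = chi8 r"
      using q(3)[of 0] q(3)[of 2] by (simp_all add: \<psi>_def e_def chi4_mod8 chi8_mod8)
    with cop_odd[OF q(2)] r show ?thesis
      by (elim insertE emptyE; simp add: chi4_def chi8_def)
  qed
  ultimately show ?thesis using that q(1) by blast
qed

section \<open>Representation by the ternary and quaternary forms\<close>

text \<open>Multiplied by the unit \<open>C\<close>, the congruence becomes
  \<open>(C s)^2 = A C\<close> modulo \<open>p\<close>.\<close>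

lemma solve_quadratic_congruence:
  fixes A C :: int
  assumes "prime p" "\<not> int p dvd C" "Legendre (A * C) (int p) = 1"
  shows "\<exists>s. int p dvd C * s\<^sup>2 - A"
proof -
  obtain y where y: "int p dvd y\<^sup>2 - A * C" using Legendre_eq_1_obtain[OF assms(3)] .
  have "coprime C (int p)" using prime_imp_coprime[of "int p" C] assms(1,2) by (simp add: coprime_commute)
  then obtain c where "[C * c = 1] (mod int p)" using cong_solve_coprime_int by blast
  hence c: "int p dvd C * c - 1" by (simp add: cong_iff_dvd_diff)
  have "C * (C * (c * y)\<^sup>2 - A) = (y\<^sup>2 - A * C) + (C * c - 1) * ((C * c + 1) * y\<^sup>2)"
    by (simp add: power2_eq_square algebra_simps)
  also have "int p dvd \<dots>" using y c by (intro dvd_add) auto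
  finally have "int p dvd C * (c * y)\<^sup>2 - A"
    using assms(1,2) by (simp add: prime_dvd_mult_iff)
  thus ?thesis by blast
qed

text \<open>Legendre's theorem with \<open>q\<close> in the middle coefficient. A factor 2 of
  \<open>b\<close> or \<open>C\<close> gives no condition, since the other two coefficients are then
  odd; \<open>q\<close> divides only one coefficient, and only once, so the relevant products are
  not squares.\<close>

lemma ternary_solution:
  fixes A b C q :: nat
  assumes q: "prime q" "2 < q"
    and pos: "A > 0" "b > 0" "C > 0"
    and sqf: "squarefree C" "squarefree (b * q)"
    and cop: "coprime A (b * q)" "coprime (b * q) C" "coprime A C"
    and b: "b \<le> 2" and qb: "\<not> q dvd b"
    and r: "int A dvd int (b * q) * r\<^sup>2 - int C"
    and LC: "Legendre (int A * int C) (int q) = 1"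
    and Lp: "\<And>p. prime p \<Longrightarrow> 2 < p \<Longrightarrow> p dvd C \<Longrightarrow> Legendre (- int (b * q) * int A) (int p) = 1"
  shows "\<exists>x y z. z \<noteq> 0 \<and> int A * x\<^sup>2 + int (b * q) * y\<^sup>2 = int C * z\<^sup>2"
proof -
  have qA: "\<not> q dvd A" and qC: "\<not> q dvd C"
    using cop q by (auto simp: coprime_mult_left_iff coprime_mult_right_iff dest!: coprime_common_divisor[of _ _ q])
  have "\<exists>s. int (b * q) dvd int C * s\<^sup>2 + (- int A)"
  proof (rule quadratic_congruence_squarefree)
    fix p assume p: "prime p" "p dvd b * q"
    show "\<exists>t. int p dvd int C * t\<^sup>2 + - int A"
    proof (cases "p = q")
      case True
      thus ?thesis using solve_quadratic_congruence[OF p(1), of "int C" "int A"] qC LC by simp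
    next
      case False
      hence "p dvd b" using p q primes_dvd_imp_eq by (auto simp: prime_dvd_mult_iff)
      hence "p \<le> b" using pos by (intro dvd_imp_le) auto
      hence p2: "p = 2" using b prime_ge_2_nat[OF p(1)] by linarith
      have "\<not> p dvd A" "\<not> p dvd C"
        using cop \<open>p dvd b\<close> p by (auto simp: coprime_mult_left_iff coprime_mult_right_iff dest!: coprime_common_divisor[of _ _ p])
      hence "int p dvd int C * 1\<^sup>2 + - int A" unfolding p2 by simp
      thus ?thesis by blast
    qed
  qed (use pos q sqf in \<open>auto simp: prime_gt_0_nat\<close>)
  then obtain s where s: "int (b * q) dvd int C * s\<^sup>2 - int A" by auto
  have "\<exists>k. int C dvd int A * k\<^sup>2 + int (b * q)"
  proof (rule quadratic_congruence_squarefree)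
    fix p assume p: "prime p" "p dvd C"
    have nd: "\<not> p dvd A" "\<not> p dvd b * q"
      by (metis cop(3) p coprime_common_divisor not_prime_unit)
         (metis cop(2) p coprime_common_divisor not_prime_unit)
    show "\<exists>t. int p dvd int A * t\<^sup>2 + int (b * q)"
    proof (cases "p = 2")
      case True
      hence "odd A" "odd (b * q)" using nd by auto
      hence "int p dvd int A * 1\<^sup>2 + int (b * q)" unfolding True by simp
      thus ?thesis by blast
    next
      case False
      hence "2 < p" using prime_ge_2_nat[OF p(1)] by linarith
      hence "Legendre (- int (b * q) * int A) (int p) = 1" using Lp p by blast
      thus ?thesis using solve_quadratic_congruence[OF p(1), of "int A" "- int (b * q)"] nd by simp
    qed
  qed (use pos sqf in auto)
  then obtain k where k: "int C dvd int A * k\<^sup>2 + int (b * q)" by auto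
  have ns: "int A * int (b * q) \<noteq> e\<^sup>2" for e
    using prime_mult_not_square[of "int q" "int A * int b" e] q qA qb
    by (auto simp: mult_ac prime_dvd_mult_iff simp flip: of_nat_mult)
  have ns': "int (b * q) * int C \<noteq> e\<^sup>2" for e
    using prime_mult_not_square[of "int q" "int b * int C" e] q qC qb
    by (auto simp: mult_ac prime_dvd_mult_iff simp flip: of_nat_mult)
  have "int A > 0" "int (b * q) > 0" "int C > 0" using pos q by (auto simp: prime_gt_0_nat)
  moreover have "coprime (int A) (int (b * q))" "coprime (int (b * q)) (int C)" "coprime (int A) (int C)"
    using cop by (simp_all only: coprime_int_iff)
  ultimately show ?thesis by (intro legendre_ternary[OF _ _ _ _ _ _ r s k ns ns'])
qed

lemma Legendre_mod_3: "Legendre (int q) 3 = 1 \<longleftrightarrow> q mod 3 = 1"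
proof -
  have c: "Legendre (int q) 3 = Legendre (int (q mod 3)) 3"
    by (rule Legendre_cong) (simp add: cong_def zmod_int)
  have "\<not> QuadRes 3 2"
  proof
    assume "QuadRes 3 2"
    then obtain y :: int where "y\<^sup>2 mod 3 = 2 mod 3" by (auto simp: QuadRes_def cong_def)
    hence "(y mod 3)\<^sup>2 mod 3 = 2" by (simp add: power_mod)
    moreover have "y mod 3 \<in> {0, 1, 2}" by auto
    ultimately show False by (elim insertE) auto
  qed
  hence "Legendre 2 3 = -1" by (simp add: Legendre_def cong_def)
  moreover have "q mod 3 \<in> {0, 1, 2}" by auto
  moreover have "Legendre 0 3 = 0" by (simp add: Legendre_def)
  moreover have "Legendre 1 3 = 1" by (rule Legendre_1) simp
  ultimately show ?thesis unfolding c by (elim insertE emptyE) auto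
qed

text \<open>For \<open>q = 1\<close> modulo 3, the reciprocity sign for 3 cancels against the symbol
  of -1, so -3 is a square modulo \<open>q\<close> and Legendre's theorem applies to
  \<open>x^2 + 3 y^2 = q z^2\<close>.\<close>

lemma prime_norm_rational:
  assumes q: "prime q" "3 < q" and L: "Legendre (int q) 3 = 1"
  shows "\<exists>k Z W :: int. k \<noteq> 0 \<and> Z\<^sup>2 + 3 * W\<^sup>2 = int q * k\<^sup>2"
proof -
  have q3: "q mod 3 = 1" using L by (simp add: Legendre_mod_3)
  have "Legendre (int 3) (int q) = (if q mod 4 = 1 then 1 else chi4 3)"
    using Legendre_reciprocity[of 3 q] q L by simp
  moreover have "Legendre (-3) (int q) = Legendre (-1) (int q) * Legendre 3 (int q)"
    using Legendre_mult[of q "-1" 3] q by simp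
  moreover have "odd q" using prime_odd_nat[of q] q by simp
  hence "q mod 4 = 1 \<or> q mod 4 = 3" by presburger
  ultimately have "Legendre (-3 * 1) (int q) = 1"
    using Legendre_minus_1[of q] q by (auto simp: chi4_def)
  from solve_quadratic_congruence[OF q(1) _ this]
  obtain s where s: "int q dvd 1 * s\<^sup>2 - (-3)" using q by auto
  have "\<exists>x y z. z \<noteq> 0 \<and> 1 * x\<^sup>2 + 3 * y\<^sup>2 = int q * z\<^sup>2"
  proof (rule legendre_ternary)
    show "3 dvd int q * 1\<^sup>2 - 1" using q3 by (simp add: mod_eq_dvd_iff[symmetric]) presburger
    show "int q dvd 1 * s\<^sup>2 + 3" using s by simp
    have nq: "\<not> (3::int) dvd int q" using q3 by presburger
    show "1 * 3 \<noteq> e\<^sup>2" for e :: int using prime_mult_not_square[of 3 1 e] by simp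
    show "3 * int q \<noteq> e\<^sup>2" for e :: int using prime_mult_not_square[of 3 "int q" e] nq by simp
    show "coprime 3 (int q)" using nq by (intro prime_imp_coprime) auto
    show "(1::int) dvd 3 * 0\<^sup>2 - int q" by simp
  qed (use q in auto)
  thus ?thesis by auto
qed

lemma Legendre_multiplicative_eqI:
  assumes "prime q" "2 < q" "g 1 = 1" "\<And>a b. g (a * b) = g a * g b"
    and "m > 0" "\<And>p. prime p \<Longrightarrow> p dvd m \<Longrightarrow> Legendre (int p) (int q) = g p"
  shows "Legendre (int m) (int q) = g m"
proof (rule multiplicative_eqI[where f = "\<lambda>n. Legendre (int n) (int q)"])
  show "Legendre (int 1) (int q) = 1" using assms by (simp add: Legendre_1)
  show "Legendre (int (a * b)) (int q) = Legendre (int a) (int q) * Legendre (int b) (int q)" for a b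
    using assms by (simp add: Legendre_mult)
qed (use assms in auto)

lemma chi_odd:
  assumes "odd n"
  shows "chi4 n \<in> {-1, 1}" "chi8 n \<in> {-1, 1}"
proof -
  have "n mod 8 \<in> {1, 3, 5, 7}" using assms by simp presburger
  thus "chi4 n \<in> {-1, 1}" "chi8 n \<in> {-1, 1}"
    unfolding chi4_mod8[of n, symmetric] chi8_mod8[of n, symmetric]
    by (elim insertE emptyE; simp add: chi4_def chi8_def)+
qed

text \<open>The prime 3 is added to the divisors of \<open>m\<close>, with value 1, so that
  \<open>prime_norm_rational\<close> applies to \<open>q\<close>.\<close>

lemma auxiliary_prime:
  fixes m :: nat
  assumes "m > 0" "r \<in> {1, 3, 5, 7}"
    and \<epsilon>: "\<And>p. prime p \<Longrightarrow> 2 < p \<Longrightarrow> p dvd 3 * m \<Longrightarrow> \<epsilon> p \<in> {-1, 1}" "\<epsilon> 3 = 1"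
  obtains q where "prime q" "3 < q" "q mod 8 = r" "\<not> q dvd m" "Legendre (int q) 3 = 1"
    "\<And>p. prime p \<Longrightarrow> 2 < p \<Longrightarrow> p dvd m \<Longrightarrow> p \<noteq> q \<and> Legendre (int q) (int p) = \<epsilon> p"
proof -
  let ?P = "{p. prime p \<and> 2 < p \<and> p dvd 3 * m}"
  have "?P \<subseteq> {..3 * m}" using assms(1) by (auto dest: dvd_imp_le)
  hence fin: "finite ?P" by (rule finite_subset) simp
  obtain q where q: "prime q" "q mod 8 = r" "q \<notin> ?P"
      "\<And>p. p \<in> ?P \<Longrightarrow> Legendre (int q) (int p) = \<epsilon> p"
    by (rule exists_prime_with_residues[OF fin _ _ assms(2), of \<epsilon>]) (use \<epsilon> in auto)
  have "q \<noteq> 2" using q(2) assms(2) by auto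
  hence "2 < q" using prime_ge_2_nat[OF q(1)] by linarith
  hence nd: "\<not> q dvd 3 * m" using q by blast
  hence "q \<noteq> 3" "\<not> q dvd m" by auto
  moreover have "Legendre (int q) 3 = 1" using q(4)[of 3] \<epsilon>(2) by simp
  moreover have "p \<noteq> q \<and> Legendre (int q) (int p) = \<epsilon> p" if "prime p" "2 < p" "p dvd m" for p
    using that q(4)[of p] \<open>\<not> q dvd m\<close> by auto
  ultimately show ?thesis using that[of q] q \<open>2 < q\<close> by simp
qed

section \<open>Squarefree values of \<open>x^2 + z^2 + z w + w^2\<close>\<close>

lemma tform1_squarefree_coprime_3:
  fixes m :: nat
  assumes m: "m > 0" "squarefree m" "\<not> 3 dvd m"
  shows "\<exists>x z w. tform 1 x z w = int m"
proof -
  \<comment> \<open>The value \<open>chi4 p\<close> makes \<open>- q\<close> a residue modulo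
    \<open>p\<close>. With \<open>q = 7\<close> modulo 8, reciprocity contributes the same sign
    again and 2 is a residue modulo \<open>q\<close>, so \<open>m\<close> is a residue modulo
    \<open>q\<close> as well.\<close>
  define \<epsilon> where "\<epsilon> p = (if p = 3 then 1 else chi4 p)" for p
  have e: "\<epsilon> p \<in> {-1, 1}" if "prime p" "2 < p" for p
    using chi_odd(1)[OF prime_odd_nat[OF that]] by (simp add: \<epsilon>_def)
  obtain q where q: "prime q" "3 < q" "q mod 8 = 7" "\<not> q dvd m" "Legendre (int q) 3 = 1"
    and L: "\<And>p. prime p \<Longrightarrow> 2 < p \<Longrightarrow> p dvd m \<Longrightarrow> p \<noteq> q \<and> Legendre (int q) (int p) = \<epsilon> p"
    by (rule auxiliary_prime[OF m(1), of 7 \<epsilon>]) (use e in \<open>auto simp: \<epsilon>_def\<close>)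
  have L': "Legendre (int q) (int p) = chi4 p" if "prime p" "2 < p" "p dvd m" for p
    using L[OF that] that(3) m(3) by (auto simp: \<epsilon>_def)
  have sq: "chi4 p * chi4 p = 1" if "prime p" "2 < p" for p
    using chi_odd(1)[OF prime_odd_nat[OF that]] by auto
  have q4: "q mod 4 = 3" using q(3) by presburger
  have "Legendre (int m) (int q) = 1"
  proof (rule Legendre_multiplicative_eqI[where g = "\<lambda>_. 1"])
    fix p assume p: "prime p" "p dvd m"
    show "Legendre (int p) (int q) = 1"
    proof (cases "p = 2")
      case True
      thus ?thesis using Legendre_2[of q] q by (simp add: chi8_def)
    next
      case False
      hence p2: "2 < p" using prime_ge_2_nat[OF p(1)] by linarith
      show ?thesis using Legendre_reciprocity[of p q] L[OF p(1) p2 p(2)] L'[OF p(1) p2 p(2)] p p2 q q4 sq[OF p(1) p2]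
        by simp
    qed
  qed (use q m in auto)
  moreover have "Legendre (- int q) (int p) = 1" if "prime p" "2 < p" "p dvd m" for p
    using Legendre_mult[of p "-1" "int q"] Legendre_minus_1[of p] L'[OF that] that sq by simp
  ultimately have "\<exists>x y z. z \<noteq> 0 \<and> int 1 * x\<^sup>2 + int (1 * q) * y\<^sup>2 = int m * z\<^sup>2"
    using q m by (intro ternary_solution[where r = 0]) (auto simp: squarefree_prime prime_imp_coprime)
  then obtain x y z :: int where "z \<noteq> 0" "1 * x\<^sup>2 + int q * y\<^sup>2 = int m * z\<^sup>2" by auto
  moreover obtain k Z W :: int where "k \<noteq> 0" "Z\<^sup>2 + 3 * W\<^sup>2 = int q * k\<^sup>2"
    using prime_norm_rational q by blast
  ultimately show ?thesis by (intro represented_of_rational) auto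
qed

text \<open>Legendre's theorem is applied to \<open>3 x^2 + q y^2 = m z^2\<close>, solvable modulo 3
  because \<open>m\<close> and \<open>q\<close> are both 1 there. Times 3 this reads
  \<open>(3 x)^2 + 3 q y^2 = 3 m z^2\<close>, and \<open>3 q\<close> is again of the form
  \<open>Z^2 + 3 W^2\<close> up to squares.\<close>

lemma tform1_squarefree_dvd_3:
  fixes m :: nat
  assumes m: "squarefree (3 * m)" "m mod 3 = 1"
  shows "\<exists>x z w. tform 1 x z w = int (3 * m)"
proof -
  have m0: "m > 0" using m(2) by (cases m) auto
  have m3: "\<not> 3 dvd m" using m(2) by presburger
  \<comment> \<open>This value makes \<open>-3 q\<close> a residue modulo \<open>p\<close>. With
    \<open>q = 5\<close> modulo 8, \<open>(p/q) = (-3/p) = (p/3)\<close> for odd \<open>p\<close>,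
    and \<open>(2/q) = -1 = (2/3)\<close>; hence \<open>(m/q) = (m/3) = 1\<close>.\<close>
  define \<epsilon> where "\<epsilon> p = (if p = 3 then 1 else Legendre (-3) (int p))" for p :: nat
  have nd3: "\<not> int p dvd 3" if "prime p" "p \<noteq> 3" for p
  proof
    assume "int p dvd 3"
    hence "p dvd 3" by presburger
    thus False using that primes_dvd_imp_eq[of p 3] by simp
  qed
  have e: "\<epsilon> p \<in> {-1, 1}" if "prime p" "2 < p" for p
    using Legendre_values[of "-3" "int p"] Legendre_eq_0_iff[of "-3" "int p"] nd3[OF that(1)] by (auto simp: \<epsilon>_def)
  obtain q where q: "prime q" "3 < q" "q mod 8 = 5" "\<not> q dvd m" "Legendre (int q) 3 = 1"
    and L: "\<And>p. prime p \<Longrightarrow> 2 < p \<Longrightarrow> p dvd m \<Longrightarrow> p \<noteq> q \<and> Legendre (int q) (int p) = \<epsilon> p"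
    by (rule auxiliary_prime[OF m0, of 5 \<epsilon>]) (use e in \<open>auto simp: \<epsilon>_def\<close>)
  have L': "p \<noteq> 3 \<and> Legendre (int q) (int p) = Legendre (-3) (int p)" if "prime p" "2 < p" "p dvd m" for p
    using L[OF that] that(3) m3 by (auto simp: \<epsilon>_def)
  have q4: "q mod 4 = 1" using q(3) by presburger
  have q3: "Legendre 3 (int q) = 1" using Legendre_reciprocity[of 3 q] q q4 by simp
  have "Legendre (int m) (int q) = Legendre (int m) (int 3)"
  proof (rule Legendre_multiplicative_eqI[where g = "\<lambda>n. Legendre (int n) (int 3)"])
    fix p assume p: "prime p" "p dvd m"
    show "Legendre (int p) (int q) = Legendre (int p) (int 3)"
    proof (cases "p = 2")
      case True
      thus ?thesis using Legendre_2[of q] Legendre_2[of 3] q by (simp add: chi8_def)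
    next
      case False
      hence p2: "2 < p" using prime_ge_2_nat[OF p(1)] by linarith
      have odd: "odd p" using prime_odd_nat[OF p(1) p2] .
      have p3: "p \<noteq> 3" using L'[OF p(1) p2 p(2)] by blast
      have "Legendre (int p) (int q) = Legendre (-3) (int p)"
        using Legendre_reciprocity[of p q] L[OF p(1) p2 p(2)] L'[OF p(1) p2 p(2)] p p2 q q4 by simp
      also have "\<dots> = chi4 p * Legendre (int 3) (int p)"
        using Legendre_mult[of p "-1" 3] Legendre_minus_1[of p] p p2 by simp
      also have "Legendre (int 3) (int p) = Legendre (int p) (int 3) * (if p mod 4 = 1 then 1 else chi4 3)"
        using Legendre_reciprocity[of 3 p] p p2 p3 by simp
      also have "(if p mod 4 = 1 then 1 else chi4 3) = chi4 p"
      proof -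
        have "p mod 4 = 1 \<or> p mod 4 = 3" using odd by presburger
        thus ?thesis by (auto simp: chi4_def)
      qed
      finally show ?thesis using chi_odd(1)[OF odd] by auto
    qed
  qed (use q m0 in \<open>auto simp: Legendre_1 Legendre_mult[of 3, simplified]\<close>)
  moreover have "Legendre (int m) 3 = 1" using m(2) by (simp add: Legendre_mod_3)
  ultimately have "Legendre (int 3 * int m) (int q) = 1"
    using Legendre_mult[of q 3 "int m"] q q3 by simp
  moreover have "Legendre (- int q * 3) (int p) = 1" if "prime p" "2 < p" "p dvd m" for p
  proof -
    have "Legendre (-3 * int q) (int p) = Legendre (-3) (int p) * Legendre (-3) (int p)"
      using Legendre_mult[of p "-3" "int q"] L'[OF that] that by simp
    moreover have "Legendre (-3) (int p) \<in> {-1, 1}"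
      using e[OF that(1,2)] L'[OF that] by (simp add: \<epsilon>_def)
    ultimately show ?thesis by (auto simp: mult.commute)
  qed
  moreover have "(3::int) dvd int q * 1\<^sup>2 - int m"
  proof -
    have "q mod 3 = 1" using q(5) by (simp add: Legendre_mod_3)
    thus ?thesis using m(2) by simp presburger
  qed
  moreover have "squarefree m" using m(1) squarefree_multD by blast
  moreover have "\<not> q dvd 3" using q by (auto dest: dvd_imp_le)
  moreover have "coprime 3 q" using q \<open>\<not> q dvd 3\<close> by (metis prime_imp_coprime coprime_commute)
  moreover have "coprime 3 m" using m3 by (intro prime_imp_coprime) auto
  ultimately have "\<exists>x y z. z \<noteq> 0 \<and> int 3 * x\<^sup>2 + int (1 * q) * y\<^sup>2 = int m * z\<^sup>2"
    using q m0 by (intro ternary_solution[where r = 1]) (auto simp: squarefree_prime prime_imp_coprime)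
  then obtain x y z :: int where z: "z \<noteq> 0" "3 * x\<^sup>2 + int q * y\<^sup>2 = int m * z\<^sup>2" by auto
  obtain k Z W :: int where k: "k \<noteq> 0" "Z\<^sup>2 + 3 * W\<^sup>2 = int q * k\<^sup>2"
    using prime_norm_rational q by blast
  have "(3 * W)\<^sup>2 + 3 * Z\<^sup>2 = (3 * int q) * k\<^sup>2" using k(2) by (simp add: power_mult_distrib)
  moreover have "1 * (3 * x)\<^sup>2 + (3 * int q) * y\<^sup>2 = int (3 * m) * z\<^sup>2" using z(2) by (simp add: power_mult_distrib)
  ultimately show ?thesis using k(1) z(1) by (intro represented_of_rational[where c = "3 * int q" and k = k and Z = "3 * W" and W = Z
        and x = "3 * x" and y = y and z = z]) auto
qed

lemma tform1_squarefree:
  fixes m :: nat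
  assumes "m > 0" "squarefree m" "m mod 9 \<noteq> 6"
  shows "\<exists>x z w. tform 1 x z w = int m"
proof (cases "3 dvd m")
  case True
  then obtain k where k: "m = 3 * k" by auto
  have "\<not> 3 dvd k"
  proof
    assume "3 dvd k"
    hence "3\<^sup>2 dvd m" unfolding k power2_eq_square by (rule mult_dvd_mono[OF dvd_refl])
    hence "is_unit (3::nat)" using assms(2) squarefreeD by blast
    thus False by simp
  qed
  hence "k mod 3 = 1" using assms(3) unfolding k by presburger
  thus ?thesis using tform1_squarefree_dvd_3[of k] assms k by simp
next
  case False
  thus ?thesis using tform1_squarefree_coprime_3 assms by blast
qed

section \<open>Squarefree values of \<open>2 x^2 + z^2 + z w + w^2\<close>\<close>

lemma Legendre_minus_2:
  assumes "prime p" "2 < p"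
  shows "Legendre (-2) (int p) = chi4 p * chi8 p"
  using Legendre_mult[OF assms, of "-1" 2] Legendre_minus_1[OF assms] Legendre_2[OF assms] by simp

text \<open>The choice \<open>(q/p) = (-2/p)\<close> serves both
  \<open>2 x^2 + q y^2 = m z^2\<close> and \<open>x^2 + 2 q y^2 = m z^2\<close>, since each asks for
  \<open>-2 q\<close> to be a residue modulo \<open>p\<close>. At 3 it agrees with the required
  value 1. The class \<open>r\<close> stays free to adjust \<open>(m/q)\<close>.\<close>

lemma auxiliary_prime_minus_2:
  fixes m :: nat
  assumes "m > 0" "odd m" "r \<in> {1, 3, 5, 7}"
  obtains q where "prime q" "3 < q" "q mod 8 = r" "\<not> q dvd m" "Legendre (int q) 3 = 1"
    "\<And>p. prime p \<Longrightarrow> 2 < p \<Longrightarrow> p dvd m \<Longrightarrow> Legendre (- int (2 * q)) (int p) = 1"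
    "Legendre (int m) (int q) = chi4 m * chi8 m * (if q mod 4 = 1 then 1 else chi4 m)"
proof -
  define \<epsilon> where "\<epsilon> p = chi4 p * chi8 p" for p :: nat
  have e: "\<epsilon> p \<in> {-1, 1}" if "prime p" "2 < p" for p
    using chi_odd[OF prime_odd_nat[OF that]] by (auto simp: \<epsilon>_def)
  obtain q where q: "prime q" "3 < q" "q mod 8 = r" "\<not> q dvd m" "Legendre (int q) 3 = 1"
    and L: "\<And>p. prime p \<Longrightarrow> 2 < p \<Longrightarrow> p dvd m \<Longrightarrow> p \<noteq> q \<and> Legendre (int q) (int p) = \<epsilon> p"
    by (rule auxiliary_prime[OF assms(1,3), of \<epsilon>]) (use e in \<open>auto simp: \<epsilon>_def chi4_def chi8_def\<close>)
  have "Legendre (- int (2 * q)) (int p) = 1" if "prime p" "2 < p" "p dvd m" for p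
    using Legendre_mult[of p "-2" "int q"] Legendre_minus_2[of p] L[OF that] e[OF that(1,2)] that
    by (auto simp: \<epsilon>_def)
  moreover have "Legendre (int m) (int q) = chi4 m * chi8 m * (if q mod 4 = 1 then 1 else chi4 m)"
  proof (rule Legendre_multiplicative_eqI[where g = "\<lambda>n. chi4 n * chi8 n * (if q mod 4 = 1 then 1 else chi4 n)"])
    fix p assume p: "prime p" "p dvd m"
    hence "p \<noteq> 2" using assms(2) by auto
    hence p2: "2 < p" using prime_ge_2_nat[OF p(1)] by linarith
    show "Legendre (int p) (int q) = chi4 p * chi8 p * (if q mod 4 = 1 then 1 else chi4 p)"
      using Legendre_reciprocity[of p q] L[OF p(1) p2 p(2)] p p2 q by (simp add: \<epsilon>_def)
  qed (use q assms in \<open>auto simp: chi4_mult chi8_mult chi4_def[of "Suc 0"] chi8_def[of "Suc 0"] mult_ac\<close>)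
  ultimately show ?thesis using that q by blast
qed

lemma tform2_squarefree_odd:
  fixes m :: nat
  assumes m: "odd m" "squarefree m"
  shows "\<exists>x z w. tform 2 x z w = int m"
proof -
  have m0: "m > 0" using m(1) by (cases m) auto
  \<comment> \<open>Needed is \<open>(2/q) * (m/q) = 1\<close>. For \<open>q = 1\<close> modulo 4,
    \<open>(m/q) = chi4 m * chi8 m\<close>, which is 1 exactly for \<open>m\<close> in the classes 1
    and 3; otherwise \<open>q = 5\<close> modulo 8 supplies \<open>(2/q) = -1\<close>.\<close>
  define r :: nat where "r = (if m mod 8 \<in> {1, 3} then 1 else 5)"
  have r: "r \<in> {1, 3, 5, 7}" by (simp add: r_def)
  obtain q where q: "prime q" "3 < q" "q mod 8 = r" "\<not> q dvd m" "Legendre (int q) 3 = 1"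
    and Lp: "\<And>p. prime p \<Longrightarrow> 2 < p \<Longrightarrow> p dvd m \<Longrightarrow> Legendre (- int (2 * q)) (int p) = 1"
    and Lm: "Legendre (int m) (int q) = chi4 m * chi8 m * (if q mod 4 = 1 then 1 else chi4 m)"
    using auxiliary_prime_minus_2[OF m0 m(1) r] by blast
  have "q mod 8 = 1 \<or> q mod 8 = 5" using q(3) by (simp add: r_def)
  hence q4: "q mod 4 = 1" by presburger
  have "m mod 8 \<in> {1, 3, 5, 7}" using m(1) by simp presburger
  hence "chi8 r * (chi4 m * chi8 m) = 1"
    unfolding r_def chi4_mod8[of m, symmetric] chi8_mod8[of m, symmetric]
    by (elim insertE emptyE; simp add: chi4_def chi8_def)
  moreover have "Legendre 2 (int q) = chi8 r"
    using Legendre_2[of q] q chi8_mod8[of q] by simp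
  ultimately have "Legendre (int 2 * int m) (int q) = 1"
    using Legendre_mult[of q 2 "int m"] q Lm q4 by simp
  moreover have "odd q" using prime_odd_nat[of q] q by simp
  moreover have "(2::int) dvd int q * 1\<^sup>2 - int m" using m(1) \<open>odd q\<close> by simp
  ultimately have "\<exists>x y z. z \<noteq> 0 \<and> int 2 * x\<^sup>2 + int (1 * q) * y\<^sup>2 = int m * z\<^sup>2"
    using q m m0 Lp by (intro ternary_solution[where r = 1]) (auto simp: squarefree_prime prime_imp_coprime mult.commute)
  then obtain x y z :: int where "z \<noteq> 0" "2 * x\<^sup>2 + int q * y\<^sup>2 = int m * z\<^sup>2" by auto
  moreover obtain k Z W :: int where "k \<noteq> 0" "Z\<^sup>2 + 3 * W\<^sup>2 = int q * k\<^sup>2"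
    using prime_norm_rational q by blast
  ultimately show ?thesis by (intro represented_of_rational) auto
qed

text \<open>Legendre's theorem is applied to the half, \<open>x^2 + 2 q y^2 = m z^2\<close>;
  doubling turns \<open>4 q y^2\<close> into \<open>q (2 y)^2\<close>.\<close>

lemma tform2_squarefree_even:
  fixes m :: nat
  assumes m: "odd m" "squarefree m" "m mod 8 \<noteq> 5"
  shows "\<exists>x z w. tform 2 x z w = int (2 * m)"
proof -
  have m0: "m > 0" using m(1) by (cases m) auto
  \<comment> \<open>Needed is \<open>(m/q) = 1\<close>. It equals \<open>chi4 m * chi8 m\<close> for
    \<open>q = 1\<close> and \<open>chi8 m\<close> for \<open>q = 3\<close> modulo 8; for
    \<open>m = 5\<close> modulo 8 both are -1, which is the excluded class.\<close>
  define r :: nat where "r = (if m mod 8 = 7 then 3 else 1)"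
  have r: "r \<in> {1, 3, 5, 7}" by (simp add: r_def)
  obtain q where q: "prime q" "3 < q" "q mod 8 = r" "\<not> q dvd m" "Legendre (int q) 3 = 1"
    and Lp: "\<And>p. prime p \<Longrightarrow> 2 < p \<Longrightarrow> p dvd m \<Longrightarrow> Legendre (- int (2 * q)) (int p) = 1"
    and Lm: "Legendre (int m) (int q) = chi4 m * chi8 m * (if q mod 4 = 1 then 1 else chi4 m)"
    using auxiliary_prime_minus_2[OF m0 m(1) r] by blast
  have "r = 1 \<or> r = 3" by (simp add: r_def)
  hence q4: "q mod 4 = 1 \<longleftrightarrow> r = 1" using q(3) by presburger
  have "m mod 8 \<in> {1, 3, 5, 7}" using m(1) by simp presburger
  hence "chi4 m * chi8 m * (if r = 1 then 1 else chi4 m) = 1"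
    using m(3) unfolding r_def chi4_mod8[of m, symmetric] chi8_mod8[of m, symmetric]
    by (elim insertE emptyE; simp add: chi4_def chi8_def)
  hence "Legendre (int 1 * int m) (int q) = 1" using Lm unfolding q4 by simp
  moreover have "odd q" using prime_odd_nat[of q] q by simp
  moreover have "squarefree (2 * q)" using \<open>odd q\<close> q
    by (intro squarefree_mult_coprime) (auto simp: squarefree_prime)
  moreover have "coprime q m" using q by (intro prime_imp_coprime) auto
  moreover have "\<not> q dvd 2" using q by (auto dest: dvd_imp_le)
  ultimately have "\<exists>x y z. z \<noteq> 0 \<and> int 1 * x\<^sup>2 + int (2 * q) * y\<^sup>2 = int m * z\<^sup>2"
    using q m m0 Lp by (intro ternary_solution[where r = 0]) auto
  then obtain x y z :: int where z: "z \<noteq> 0" "x\<^sup>2 + 2 * int q * y\<^sup>2 = int m * z\<^sup>2" by auto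
  have "2 * x\<^sup>2 + int q * (2 * y)\<^sup>2 = 2 * (x\<^sup>2 + 2 * int q * y\<^sup>2)" by (simp add: power_mult_distrib)
  also have "\<dots> = int (2 * m) * z\<^sup>2" unfolding z(2) by simp
  finally have "2 * x\<^sup>2 + int q * (2 * y)\<^sup>2 = int (2 * m) * z\<^sup>2" .
  moreover obtain k Z W :: int where "k \<noteq> 0" "Z\<^sup>2 + 3 * W\<^sup>2 = int q * k\<^sup>2"
    using prime_norm_rational q by blast
  ultimately show ?thesis
    using z(1) by (intro represented_of_rational[where c = "int q" and x = x and y = "2 * y" and z = z]) auto
qed

lemma tform2_squarefree:
  fixes m :: nat
  assumes "squarefree m" "m mod 16 \<noteq> 10"
  shows "\<exists>x z w. tform 2 x z w = int m"
proof (cases "even m")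
  case True
  then obtain k where k: "m = 2 * k" by auto
  have "odd k"
  proof
    assume "even k"
    hence "2\<^sup>2 dvd m" unfolding k power2_eq_square by (rule mult_dvd_mono[OF dvd_refl])
    hence "is_unit (2::nat)" using assms(1) squarefreeD by blast
    thus False by simp
  qed
  moreover have "squarefree k" using assms(1) k squarefree_multD by blast
  moreover have "k mod 8 \<noteq> 5" using assms(2) unfolding k by presburger
  ultimately show ?thesis using tform2_squarefree_even[of k] k by simp
next
  case False
  thus ?thesis using tform2_squarefree_odd assms by blast
qed

lemma squarefree_times_square:
  fixes n :: nat
  assumes "n > 0"
  obtains s m where "n = s\<^sup>2 * m" "squarefree m" "m > 0"
proof
  show "n = (square_part n)\<^sup>2 * squarefree_part n" by (subst squarefree_decompose) (rule mult.commute)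
  show "squarefree (squarefree_part n)" by simp
  show "squarefree_part n > 0" by (rule gr0I) simp
qed

lemma tform_scale: "tform a (s * x) (s * z) (s * w) = s\<^sup>2 * tform a x z w"
  by (simp add: tform_def power2_eq_square algebra_simps)

text \<open>A squarefree part in the class 6 makes the number \<open>6 s^2\<close>, which is 0 or 6
  modulo 9.\<close>

lemma tform1_represents:
  fixes m :: nat
  assumes "m mod 9 \<noteq> 0" "m mod 9 \<noteq> 6"
  shows "\<exists>x z w. tform 1 x z w = int m"
proof -
  have "m > 0" using assms(1) by (cases m) auto
  then obtain s k where k: "m = s\<^sup>2 * k" "squarefree k" "k > 0" using squarefree_times_square by blast
  have "k mod 9 \<noteq> 6"
  proof
    assume "k mod 9 = 6"
    hence "m mod 9 = ((s mod 9)\<^sup>2 * 6) mod 9" unfolding k by (metis mod_mult_eq power_mod mod_mult_right_eq mod_mult_left_eq)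
    moreover have "s mod 9 \<in> {0, 1, 2, 3, 4, 5, 6, 7, 8}" by (simp only: insert_iff empty_iff) presburger
    ultimately show False using assms by (elim insertE emptyE) simp_all
  qed
  then obtain x z w where "tform 1 x z w = int k" using tform1_squarefree k by blast
  thus ?thesis using tform_scale[of 1 "int s" x z w] k by auto
qed

text \<open>A squarefree part in the class 10 makes the number \<open>10 s^2\<close>, which is 0, 8
  or 10 modulo 16.\<close>

lemma tform2_represents:
  fixes m :: nat
  assumes "m mod 16 \<noteq> 0" "m mod 16 \<noteq> 8" "m mod 16 \<noteq> 10"
  shows "\<exists>x z w. tform 2 x z w = int m"
proof -
  have "m > 0" using assms(1) by (cases m) auto
  then obtain s k where k: "m = s\<^sup>2 * k" "squarefree k" "k > 0" using squarefree_times_square by blast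
  have "k mod 16 \<noteq> 10"
  proof
    assume "k mod 16 = 10"
    hence "m mod 16 = ((s mod 16)\<^sup>2 * 10) mod 16" unfolding k by (metis mod_mult_eq power_mod mod_mult_right_eq mod_mult_left_eq)
    moreover have "s mod 16 \<in> {0, 1, 2, 3, 4, 5, 6, 7, 8, 9, 10, 11, 12, 13, 14, 15}" by (simp only: insert_iff empty_iff) presburger
    ultimately show False using assms by (elim insertE emptyE) simp_all
  qed
  then obtain x z w where "tform 2 x z w = int k" using tform2_squarefree k by blast
  thus ?thesis using tform_scale[of 2 "int s" x z w] k by auto
qed

section \<open>The quaternary forms\<close>

lemma representsI: "tform a x z w = n - b * y\<^sup>2 \<Longrightarrow> represents a b n"
  unfolding represents_def by (intro exI[of _ x] exI[of _ y] exI[of _ z] exI[of _ w]) (simp add: f1_def tform_def)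

lemma represents_scale: "represents a b n \<Longrightarrow> represents a b (s\<^sup>2 * n)"
proof -
  assume "represents a b n"
  then obtain x y z w where "f1 a b x y z w = n" by (auto simp: represents_def)
  hence "f1 a b (s * x) (s * y) (s * z) (s * w) = s\<^sup>2 * n"
    by (auto simp: f1_def power2_eq_square algebra_simps)
  thus ?thesis unfolding represents_def by blast
qed

lemma represents_all_of_squarefree:
  assumes "\<And>m::nat. squarefree m \<Longrightarrow> m > 0 \<Longrightarrow> represents a b (int m)" and "n \<ge> 0"
  shows "represents a b n"
proof (cases "n = 0")
  case True
  thus ?thesis using representsI[of a 0 0 0 n b 0] by (simp add: tform_def)
next
  case False
  then obtain s m where m: "nat n = s\<^sup>2 * m" "squarefree m" "m > 0"
    using squarefree_times_square[of "nat n"] assms(2) by auto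
  have "n = (int s)\<^sup>2 * int m" using m(1) assms(2) by (metis int_nat_eq of_nat_mult of_nat_power)
  thus ?thesis using represents_scale assms(1) m by simp
qed

lemma represents_1:
  assumes b: "b \<in> {1..6}" and "n \<ge> 0"
  shows "represents 1 b n"
  using assms(2)
proof (rule represents_all_of_squarefree[rotated])
  fix m :: nat assume m: "squarefree m" "m > 0"
  show "represents 1 b (int m)"
  proof (cases "m mod 9 = 6")
    case False
    then obtain x z w where "tform 1 x z w = int m" using tform1_squarefree m by blast
    thus ?thesis by (intro representsI[where y = 0]) simp
  next
    case True
    define l where "l = m div 9"
    have l: "m = 9 * l + 6" using True unfolding l_def by presburger
    \<comment> \<open>For \<open>b \<le> 5\<close>, \<open>y = 1\<close> leaves a residue from 1 to
      5 modulo 9. For \<open>b = 6\<close> it leaves \<open>9 * l\<close>; if \<open>l\<close> is in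
      the class 0 or 6, \<open>y = 2\<close> leaves \<open>9 * (l - 2)\<close>, with
      \<open>l - 2\<close> in the class 7 or 4.\<close>
    consider "b \<le> 5" | "b = 6" "l = 0" | "b = 6" "l mod 9 \<noteq> 0" "l mod 9 \<noteq> 6"
      | "b = 6" "l \<noteq> 0" "l mod 9 = 0 \<or> l mod 9 = 6"
      using b by fastforce
    thus ?thesis
    proof cases
      case 1
      define c where "c = 6 - nat b"
      have c: "1 \<le> c" "c \<le> 5" "b = 6 - int c" using b 1 by (auto simp: c_def)
      have "(9 * l + c) mod 9 = c" using c by simp
      then obtain x z w where "tform 1 x z w = int (9 * l + c)" using tform1_represents[of "9 * l + c"] c by auto
      thus ?thesis by (intro representsI[where y = 1]) (simp add: l c(3))
    next
      case 2
      thus ?thesis by (intro representsI[where x = 0 and z = 0 and w = 0 and y = 1]) (simp add: l tform_def)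
    next
      case 3
      then obtain x z w where "tform 1 x z w = int l" using tform1_represents by blast
      hence "tform 1 (3 * x) (3 * z) (3 * w) = 9 * int l" by (simp add: tform_scale)
      thus ?thesis by (intro representsI[where y = 1]) (simp add: l 3)
    next
      case 4
      hence "l \<ge> 2" by (cases "l = 1") auto
      then obtain k where k: "l = k + 2" by (metis add.commute le_Suc_ex)
      have "k mod 9 \<noteq> 0" "k mod 9 \<noteq> 6" using 4(3) unfolding k by presburger+
      then obtain x z w where "tform 1 x z w = int k" using tform1_represents by blast
      hence "tform 1 (3 * x) (3 * z) (3 * w) = 9 * int k" by (simp add: tform_scale)
      thus ?thesis by (intro representsI[where y = 2]) (simp add: l k 4)
    qed
  qed
qed

lemma represents_2:
  assumes b: "b \<in> {2..10}" and "n \<ge> 0"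
  shows "represents 2 b n"
  using assms(2)
proof (rule represents_all_of_squarefree[rotated])
  fix m :: nat assume m: "squarefree m" "m > 0"
  show "represents 2 b (int m)"
  proof (cases "m mod 16 = 10")
    case False
    then obtain x z w where "tform 2 x z w = int m" using tform2_squarefree m by blast
    thus ?thesis by (intro representsI[where y = 0]) simp
  next
    case True
    define l where "l = m div 16"
    have l: "m = 16 * l + 10" using True unfolding l_def by presburger
    \<comment> \<open>For \<open>b = 2\<close>, \<open>y = 1\<close> would leave 8 modulo 16, so
      \<open>y = 2\<close> is taken, which leaves 2. For \<open>3 \<le> b \<le> 9\<close>,
      \<open>y = 1\<close> leaves a residue from 1 to 7. For \<open>b = 10\<close> with
      \<open>l\<close> in a bad class, \<open>y = 2\<close> leaves
      \<open>16 * (l - 2) + 2\<close>.\<close>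
    consider "b = 2" | "b \<ge> 3" "b \<le> 9" | "b = 10" "l = 0" | "b = 10" "l mod 16 \<noteq> 0" "l mod 16 \<noteq> 8" "l mod 16 \<noteq> 10"
      | "b = 10" "l \<noteq> 0" "l mod 16 = 0 \<or> l mod 16 = 8 \<or> l mod 16 = 10"
      using b by fastforce
    thus ?thesis
    proof cases
      case 1
      have "(16 * l + 2) mod 16 = 2" by presburger
      then obtain x z w where "tform 2 x z w = int (16 * l + 2)" using tform2_represents[of "16 * l + 2"] by auto
      thus ?thesis by (intro representsI[where y = 2]) (simp add: l 1)
    next
      case 2
      define c where "c = 10 - nat b"
      have c: "1 \<le> c" "c \<le> 7" "b = 10 - int c" using b 2 by (auto simp: c_def)
      have "(16 * l + c) mod 16 = c" using c by simp
      then obtain x z w where "tform 2 x z w = int (16 * l + c)" using tform2_represents[of "16 * l + c"] c by auto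
      thus ?thesis by (intro representsI[where y = 1]) (simp add: l c(3))
    next
      case 3
      thus ?thesis by (intro representsI[where x = 0 and z = 0 and w = 0 and y = 1]) (simp add: l tform_def)
    next
      case 4
      then obtain x z w where "tform 2 x z w = int l" using tform2_represents by blast
      hence "tform 2 (4 * x) (4 * z) (4 * w) = 16 * int l" by (simp add: tform_scale)
      thus ?thesis by (intro representsI[where y = 1]) (simp add: l 4)
    next
      case 5
      hence "l \<ge> 2" by (cases "l = 1") auto
      then obtain k where k: "l = k + 2" by (metis add.commute le_Suc_ex)
      have "(16 * k + 2) mod 16 = 2" by presburger
      then obtain x z w where "tform 2 x z w = int (16 * k + 2)" using tform2_represents[of "16 * k + 2"] by auto
      thus ?thesis by (intro representsI[where y = 2]) (simp add: l k 5)
    qed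
  qed
qed

section \<open>Necessity, from the numbers 2, 6 and 10\<close>

lemma eisenstein_norm_small:
  fixes z w :: int
  assumes "z\<^sup>2 + z * w + w\<^sup>2 \<le> 10"
  shows "z\<^sup>2 + z * w + w\<^sup>2 \<in> {0, 1, 3, 4, 7, 9}"
proof -
  have small: "v \<in> {-3, -2, -1, 0, 1, 2, 3}" if "u\<^sup>2 + u * v + v\<^sup>2 \<le> 10" for u v :: int
  proof -
    have "4 * (u\<^sup>2 + u * v + v\<^sup>2) = (2 * u + v)\<^sup>2 + 3 * v\<^sup>2" by (simp add: power2_eq_square algebra_simps)
    moreover have "3 * V \<le> 40" if "4 * S = A + 3 * V" "S \<le> 10" "0 \<le> A" for A S V :: int
      using that by linarith
    ultimately have "3 * v\<^sup>2 \<le> 40" using \<open>u\<^sup>2 + u * v + v\<^sup>2 \<le> 10\<close> zero_le_power2 by blast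
    hence "v\<^sup>2 < 4\<^sup>2" by simp
    hence "\<bar>v\<bar> < 4" by (metis power2_less_imp_less power2_abs zero_le_numeral)
    thus ?thesis by (simp only: insert_iff empty_iff) presburger
  qed
  have "z \<in> {-3, -2, -1, 0, 1, 2, 3}" using small[of w z] assms by (simp add: algebra_simps)
  moreover have "w \<in> {-3, -2, -1, 0, 1, 2, 3}" using small[of z w] assms by simp
  ultimately show ?thesis using assms by (elim insertE emptyE) simp_all
qed

lemma tform_le_10_cases:
  assumes "a > 0" "tform a x z w = n" "n \<le> 10"
  obtains "n \<in> {0, 1, 3, 4, 7, 9}" | "n - a \<in> {0, 1, 3, 4, 7, 9}"
    | "n - a * 4 \<in> {0, 1, 3, 4, 7, 9}" | "n - a * 9 \<in> {0, 1, 3, 4, 7, 9}"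
proof -
  have n: "n - a * x\<^sup>2 = z\<^sup>2 + z * w + w\<^sup>2" using assms(2) by (simp add: tform_def)
  have le: "x\<^sup>2 \<le> a * x\<^sup>2" using assms(1) mult_right_mono[of 1 a "x\<^sup>2"] by simp
  hence "0 \<le> a * x\<^sup>2" using zero_le_power2[of x] by linarith
  hence N: "n - a * x\<^sup>2 \<in> {0, 1, 3, 4, 7, 9}"
    unfolding n using n assms(3) by (intro eisenstein_norm_small) linarith
  hence "0 \<le> n - a * x\<^sup>2" by auto
  hence "x\<^sup>2 < 4\<^sup>2" using le assms(3) by simp
  hence "\<bar>x\<bar> < 4" by (metis power2_less_imp_less power2_abs zero_le_numeral)
  hence "x \<in> {-3, -2, -1, 0, 1, 2, 3}" by (simp only: insert_iff empty_iff) presburger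
  hence "x\<^sup>2 = 0 \<or> x\<^sup>2 = 1 \<or> x\<^sup>2 = 4 \<or> x\<^sup>2 = 9" by (elim insertE emptyE) simp_all
  thus ?thesis using that N by (metis diff_zero mult_1_right mult_zero_right)
qed

text \<open>The ternary part is nonnegative, and a nonzero \<open>y\<close> would already contribute
  at least \<open>b\<close>.\<close>

lemma represents_small:
  assumes "represents a b n" "a > 0" "b > 0" "b > n"
  shows "\<exists>x z w. tform a x z w = n"
proof -
  obtain x y z w where f: "f1 a b x y z w = n" using assms(1) by (auto simp: represents_def)
  hence t: "tform a x z w = n - b * y\<^sup>2" by (simp add: f1_def tform_def)
  have "4 * a * x\<^sup>2 \<ge> 0" using assms(2) by simp
  hence "tform a x z w \<ge> 0"
    using four_tform[of a x z w] zero_le_power2[of "2 * z + w"] zero_le_power2[of w] by linarith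
  have "y = 0"
  proof (rule ccontr)
    assume "y \<noteq> 0"
    hence "1 \<le> y\<^sup>2" by (simp add: int_one_le_iff_zero_less)
    hence "b \<le> b * y\<^sup>2" using mult_left_mono[of 1 "y\<^sup>2" b] assms(3) by simp
    thus False using t \<open>tform a x z w \<ge> 0\<close> assms(4) by linarith
  qed
  thus ?thesis using t by auto
qed

text \<open>Beyond the bounds \<open>y\<close> must vanish, and the ternary form misses 2 for
  \<open>a \<ge> 3\<close>, 6 for \<open>a = 1\<close> and 10 for \<open>a = 2\<close>: the
  nonnegative remainders 2, then 6, 5, 2, then 10, 8, 2 are no values of
  \<open>z^2 + z w + w^2\<close>.\<close>

lemma represents_cases:
  fixes a b :: int
  assumes ab: "0 < a" "a \<le> b" and rep: "represents a b 2" "represents a b 6" "represents a b 10"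
  shows "(a = 1 \<and> b \<in> {1..6}) \<or> (a = 2 \<and> b \<in> {2..10})"
proof -
  have "a \<le> 2"
  proof (rule ccontr)
    assume "\<not> a \<le> 2"
    then obtain x z w where "tform a x z w = 2" using represents_small[OF rep(1)] ab by auto
    thus False by (rule tform_le_10_cases[OF ab(1)]) (use \<open>\<not> a \<le> 2\<close> in auto)
  qed
  hence "a = 1 \<or> a = 2" using ab(1) by linarith
  moreover have "b \<le> 6" if "a = 1"
  proof (rule ccontr)
    assume "\<not> b \<le> 6"
    moreover have "represents 1 b 6" using rep(2) that by simp
    ultimately obtain x z w where "tform 1 x z w = 6" using represents_small[of 1 b 6] ab by auto
    thus False by (rule tform_le_10_cases[rotated]) auto
  qed
  moreover have "b \<le> 10" if "a = 2"
  proof (rule ccontr)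
    assume "\<not> b \<le> 10"
    moreover have "represents 2 b 10" using rep(3) that by simp
    ultimately obtain x z w where "tform 2 x z w = 10" using represents_small[of 2 b 10] ab by auto
    thus False by (rule tform_le_10_cases[rotated]) auto
  qed
  ultimately show ?thesis using ab by auto
qed

theorem theorem3p8:
  fixes a b :: int
  assumes "0 < a" and "a \<le> b"
  shows "((\<forall>n\<ge>0. represents a b n) \<longleftrightarrow>
           ((a = 1 \<and> b \<in> {1..6}) \<or> (a = 2 \<and> b \<in> {2..10})))
       \<and> ((represents a b 1 \<and> represents a b 2 \<and> represents a b 6 \<and> represents a b 10)
           \<longrightarrow> (\<forall>n\<ge>0. represents a b n))"
proof -
  have "\<forall>n\<ge>0. represents a b n" if "(a = 1 \<and> b \<in> {1..6}) \<or> (a = 2 \<and> b \<in> {2..10})"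
    using that represents_1 represents_2 by blast
  moreover have "(a = 1 \<and> b \<in> {1..6}) \<or> (a = 2 \<and> b \<in> {2..10})"
    if "represents a b 2" "represents a b 6" "represents a b 10"
    using represents_cases[OF assms that] .
  ultimately show ?thesis by auto
qed

end
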